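(* For any positive integer $m$ and real $a\geq 2m$, \begin{align*} &\frac{2^{m-2}(1-(-1)^m i^{a+1})}{i^m(1+i)^{a-1}}\int_0^\infty \frac{x^a\, dx}{(\cos x-\cosh x)^m}\\ &=\sum_{l=0}^{\lfloor (m-1)/2\rfloor}\sum_{j=0}^{m-1-2l}\frac{(-1)^{l+1}2^l\gamma_{l,m}}{(m-1-2l-j)!}\binom{a}{j}\pi^{a+1-j}\lim_{y\to\pi}\frac{d^{m-1-2l-j}}{dy^{m-1-2l-j}}\left\{\sum_{n=1}^\infty(-1)^{mn}\frac{n^{a+1+2l-m}}{\sinh^m(n y)}\right\}. \end{align*}
   Context: $\gamma_{l,m}:=(-1)^m2^l\sum_{k_1+\cdots+k_m=l,\ k_j\ge0}\prod_{j=1}^m\frac{(1-2^{1-2k_j})B_{2k_j}}{(2k_j)!}$, where $B_n$ are the Bernoulli numbers ($\frac{x}{e^x-1}=\sum_{n\ge0}\frac{B_n}{n!}x^n$). For real $a$, $\binom{a}{j}=\frac{a(a-1)\cdots(a-j+1)}{j!}$, and the complex powers $i^{a+1}$, $(1+i)^{a-1}$ are taken with the principal branch. *)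

theory Defs
  imports
    "HOL-Analysis.Analysis"
    "HOL-Computational_Algebra.Formal_Power_Series"
begin

definition bernoulli_number :: "nat \<Rightarrow> real" where
  "bernoulli_number n = fact n * fps_nth (fps_X / (fps_exp 1 - 1)) n"

text \<open>
  The tuples of nonnegative integers with sum \<open>l\<close>, indexed by \<open>{1..m}\<close>. Using extensional
  functions (with value \<open>undefined\<close> outside \<open>{1..m}\<close>) makes each tuple occur exactly once.
\<close>

definition weak_compositions :: "nat \<Rightarrow> nat \<Rightarrow> (nat \<Rightarrow> nat) set" where
  "weak_compositions l m = {k \<in> {1..m} \<rightarrow>\<^sub>E UNIV. (\<Sum>j=1..m. k j) = l}"

lemma finite_weak_compositions: "finite (weak_compositions l m)"
proof (rule finite_subset)
  show "weak_compositions l m \<subseteq> {1..m} \<rightarrow>\<^sub>E {..l}"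
  proof
    fix k assume k: "k \<in> weak_compositions l m"
    have "k j \<le> l" if "j \<in> {1..m}" for j
      using k member_le_sum[of j "{1..m}" k] that by (auto simp: weak_compositions_def)
    with k show "k \<in> {1..m} \<rightarrow>\<^sub>E {..l}"
      by (auto simp: weak_compositions_def PiE_iff)
  qed
  show "finite ({1..m} \<rightarrow>\<^sub>E {..l})"
    by (intro finite_PiE) auto
qed

definition gamma_coeff :: "nat \<Rightarrow> nat \<Rightarrow> real" where
  "gamma_coeff l m = (-1) ^ m * 2 ^ l *
     (\<Sum>k\<in>weak_compositions l m.
        \<Prod>j=1..m. (1 - 2 powi (1 - 2 * int (k j))) * bernoulli_number (2 * k j) / fact (2 * k j))"

text \<open>
  The series \<open>\<Sum>n\<ge>1. (-1)^(m n) n^s / sinh(n y)^m\<close>, split into its terms and its sum. The terms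
  are indexed from \<open>0\<close>, so the \<open>n\<close>-th one carries \<open>Suc n\<close>.
\<close>

definition sinh_term :: "nat \<Rightarrow> real \<Rightarrow> real \<Rightarrow> nat \<Rightarrow> real" where
  "sinh_term m s y n = (-1) ^ (m * Suc n) * real (Suc n) powr s / sinh (real (Suc n) * y) ^ m"

definition sinh_series :: "nat \<Rightarrow> real \<Rightarrow> real \<Rightarrow> real" where
  "sinh_series m s y = (\<Sum>n. sinh_term m s y n)"

end

theory Submission
  imports
    Defs
    "HOL-Complex_Analysis.Complex_Analysis"
    "HOL-Real_Asymp.Real_Asymp"
begin

text \<open>
  With \<open>z = (1 + \<i>) u\<close> one has \<open>cos z - cosh z = -2 \<i> sinh u sin u\<close>, so the integral over the positive
  real axis and its rotation by \<open>\<i>\<close> become the integrals of \<open>u\<^sup>a / (sinh u sin u)\<^sup>m\<close> over the two rays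
  \<open>arg u = \<plusminus>\<pi>/4\<close>. Between these rays the function has poles exactly at \<open>u = n \<pi>\<close>, and the residue
  theorem on the triangles cut off by \<open>Re u = (N + 1/2) \<pi>\<close> expresses the difference of the ray integrals
  as the sum of the residues. Expanding \<open>(w / sin w)\<^sup>m\<close> at each pole produces the coefficients
  \<open>gamma_coeff l m\<close>, the binomial series of \<open>(n \<pi> + w)\<^sup>a\<close> produces the binomial coefficients, and the
  Taylor coefficients of \<open>1 / sinh\<^sup>m\<close> at \<open>n \<pi>\<close> are those of the terms of the series at \<open>\<pi>\<close>, up to
  powers of \<open>n\<close>.
\<close>

section \<open>The power series of w / sin w\<close>

text \<open>Both ray integrals are multiples of one real integral: \<open>(1 + \<i>) u\<close> is
  real on the ray through \<open>1 - \<i>\<close> and imaginary on the ray through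
  \<open>1 + \<i>\<close>, where \<open>cos\<close> and \<open>cosh\<close> change places. This
  costs \<open>(-1)^m\<close> and a quotient of principal powers, hence the factor
  \<open>1 - (-1)^m \<i>^(a+1)\<close>. For non-integral \<open>a\<close> the integrand is
  multivalued, but the sector lies in the right half-plane, where the principal power is
  holomorphic. The apex must tend to 0 and the far side to infinity; both limits are taken together,
  under one exponentially decaying majorant for all shifted rays. The powers of \<open>n\<close>
  agree because the pole \<open>n \<pi>\<close> contributes \<open>n^(a-j)\<close>, while
  \<open>k = m-1-2l-j\<close> derivatives in \<open>y\<close> raise \<open>n^(a+1+2l-m)\<close> to
  exactly \<open>n^(a-j)\<close>. Matching the residue sum with derivatives of the series requires
  termwise differentiation. For complex \<open>y\<close>, locally uniform convergence of the series
  itself is enough for this, so the series is extended to the right half-plane and its derivatives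
  are restricted to the real axis afterwards. The sum is smooth for \<open>y > 0\<close>, so the
  limits at \<pi> are values.\<close>

lemma fps_power_nth_weak_compositions:
  fixes U :: "'a :: comm_ring_1 fps"
  shows "fps_nth (U ^ m) l = (\<Sum>k\<in>weak_compositions l m. \<Prod>j=1..m. fps_nth U (k j))"
proof (cases m)
  case 0
  have *: "weak_compositions l 0 = (if l = 0 then {\<lambda>_. undefined} else {})"
    by (auto simp: weak_compositions_def)
  show ?thesis
    by (simp add: 0 *)
next
  case (Suc m')
  \<comment> \<open>\<open>fps_power_nth\<close> sums over lists of length \<open>m\<close>, indexed
    from 0; \<open>gamma_coeff\<close> sums over extensional functions on \<open>{1..m}\<close>. The
    bijection shifts the index by one.\<close>
  have "(\<Sum>v\<in>natpermute l m. \<Prod>j=0..m'. fps_nth U (v ! j)) =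
        (\<Sum>k\<in>weak_compositions l m. \<Prod>j=1..m. fps_nth U (k j))"
  proof (rule sum.reindex_bij_witness[where
        i = "\<lambda>k. map k [1..<Suc m]" and j = "\<lambda>v. \<lambda>j\<in>{1..m}. v ! (j - 1)"])
    fix v assume v: "v \<in> natpermute l m"
    hence len: "length v = m" and sm: "sum_list v = l"
      by (auto simp: natpermute_def)
    show "map (\<lambda>j\<in>{1..m}. v ! (j - 1)) [1..<Suc m] = v"
      using len by (intro nth_equalityI) (auto simp del: upt_Suc)
    have "(\<Sum>j=1..m. v ! (j - 1)) = (\<Sum>j=0..<m. v ! j)"
      by (rule sum.reindex_bij_witness[of _ Suc "\<lambda>j. j - 1"]) auto
    also have "\<dots> = l"
      using sm len by (simp add: sum_list_sum_nth)
    finally show "(\<lambda>j\<in>{1..m}. v ! (j - 1)) \<in> weak_compositions l m"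
      by (auto simp: weak_compositions_def)
    show "(\<Prod>j=1..m. fps_nth U ((\<lambda>j\<in>{1..m}. v ! (j - 1)) j)) = (\<Prod>j=0..m'. fps_nth U (v ! j))"
      by (rule prod.reindex_bij_witness[of _ Suc "\<lambda>j. j - 1"]) (auto simp: Suc)
  next
    fix k assume k: "k \<in> weak_compositions l m"
    show "(\<lambda>j\<in>{1..m}. map k [1..<Suc m] ! (j - 1)) = k"
      using k by (auto simp: weak_compositions_def fun_eq_iff PiE_def extensional_def simp del: upt_Suc)
    have "sum_list (map k [1..<Suc m]) = (\<Sum>j=1..m. k j)"
      by (simp add: interv_sum_list_conv_sum_set_nat atLeastLessThanSuc_atLeastAtMost del: upt_Suc)
    thus "map k [1..<Suc m] \<in> natpermute l m"
      using k by (simp add: natpermute_def weak_compositions_def del: upt_Suc)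
  qed
  thus ?thesis
    by (simp add: fps_power_nth Suc del: power_Suc prod.cl_ivl_Suc)
qed

text \<open>With \<open>B(x) = x / (exp x - 1)\<close> one has
  \<open>x / sinh x = 2 B(x) - B(2 x)\<close>, which gives the factor \<open>2 - 2^n\<close>;
  putting \<open>x = \<i> w\<close> gives \<open>w / sin w\<close> and the factor
  \<open>\<i>^n\<close>.\<close>

definition fps_X_over_sin :: "complex fps" where
  "fps_X_over_sin = Abs_fps (\<lambda>n. \<i> ^ n * (2 - 2 ^ n) * of_real (bernoulli_number n) / fact n)"

text \<open>The quotient defining \<open>bernoulli_number\<close> is exact because
  \<open>exp x - 1\<close> has subdegree 1 and so divides \<open>fps_X\<close>. The resulting
  product identity is then carried over coefficientwise from real to complex series.\<close>

lemma fps_bernoulli_mult: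
  "Abs_fps (\<lambda>n. of_real (bernoulli_number n) / fact n) * (fps_exp 1 - 1) = (fps_X :: complex fps)"
proof -
  define b :: "real fps" where "b = fps_X / (fps_exp 1 - 1)"
  have sub: "subdegree (fps_exp 1 - 1 :: real fps) = 1"
    by (rule subdegreeI) auto
  have "(fps_exp 1 - 1 :: real fps) dvd fps_X"
  proof -
    have "(fps_exp 1 - 1 :: real fps) \<noteq> 0"
      using sub by auto
    thus ?thesis
      by (subst fps_dvd_iff) (use sub in auto)
  qed
  hence b: "b * (fps_exp 1 - 1) = fps_X"
    unfolding b_def by simp
  have nth: "bernoulli_number n / fact n = fps_nth b n" for n
    by (simp add: bernoulli_number_def b_def)
  show ?thesis
  proof (rule fps_ext)
    fix n
    have "fps_nth (Abs_fps (\<lambda>n. of_real (bernoulli_number n) / fact n) * (fps_exp 1 - 1)) n =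
          complex_of_real (fps_nth (b * (fps_exp 1 - 1)) n)"
      by (auto simp: fps_mult_nth nth [symmetric] intro!: sum.cong)
    also have "\<dots> = fps_nth (fps_X :: complex fps) n"
      by (simp add: b fps_X_def)
    finally show "fps_nth (Abs_fps (\<lambda>n. of_real (bernoulli_number n) / fact n) * (fps_exp 1 - 1)) n =
        fps_nth (fps_X :: complex fps) n" .
  qed
qed

lemma fps_X_over_sin: "fps_X_over_sin * fps_sin 1 = fps_X"
proof -
  define B :: "complex fps" where "B = Abs_fps (\<lambda>n. of_real (bernoulli_number n) / fact n)"
  \<comment> \<open>\<open>S\<close> is the series of \<open>x / sinh x\<close>.\<close>
  define S where "S = fps_const 2 * B - (B oo (fps_const 2 * fps_X))"
  have B: "B * (fps_exp 1 - 1) = fps_X"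
    unfolding B_def by (rule fps_bernoulli_mult)
  have exp2: "fps_exp 2 = fps_exp 1 * fps_exp (1 :: complex)"
    by (simp flip: fps_exp_add_mult)
  have expm: "fps_exp (-1) * fps_exp (1 :: complex) = 1"
    by (simp flip: fps_exp_add_mult)
  have "(B oo (fps_const 2 * fps_X)) * (fps_exp 2 - 1) = (B * (fps_exp 1 - 1)) oo (fps_const 2 * fps_X)"
    by (simp add: fps_compose_mult_distrib fps_compose_sub_distrib)
  also have "\<dots> = fps_const 2 * fps_X"
    unfolding B by simp
  finally have B2: "(B oo (fps_const 2 * fps_X)) * (fps_exp 2 - 1) = fps_const 2 * fps_X" .
  have "S * (fps_exp 2 - 1) = fps_const 2 * (B * (fps_exp 1 - 1)) * (fps_exp 1 + 1)
          - (B oo (fps_const 2 * fps_X)) * (fps_exp 2 - 1)"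
    unfolding S_def by (simp add: exp2 algebra_simps)
  also have "\<dots> = fps_const 2 * fps_X * fps_exp 1"
    unfolding B B2 by (simp add: algebra_simps)
  \<comment> \<open>Multiplying by \<open>exp (-x)\<close> makes the equation symmetric:
    \<open>exp (2 x) - 1\<close> becomes \<open>exp x - exp (-x)\<close>.\<close>
  finally have "fps_exp (-1) * (S * (fps_exp 2 - 1)) = fps_const 2 * fps_X * (fps_exp (-1) * fps_exp 1)"
    by (simp add: mult_ac)
  also have "fps_exp (-1) * (S * (fps_exp 2 - 1)) = S * (fps_exp 1 * (fps_exp (-1) * fps_exp 1) - fps_exp (-1))"
    by (simp add: exp2 algebra_simps)
  finally have S: "S * (fps_exp 1 - fps_exp (-1)) = fps_const 2 * fps_X"
    by (simp add: expm)
  have "(S oo (fps_const \<i> * fps_X)) * (fps_exp \<i> - fps_exp (-\<i>)) =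
        (S * (fps_exp 1 - fps_exp (-1))) oo (fps_const \<i> * fps_X)"
    by (simp add: fps_compose_mult_distrib fps_compose_sub_distrib)
  also have "\<dots> = fps_const (2 * \<i>) * fps_X"
    unfolding S by (simp add: fps_compose_mult_distrib flip: fps_const_mult)
  finally have "(S oo (fps_const \<i> * fps_X)) * (fps_exp \<i> - fps_exp (-\<i>)) = fps_const (2 * \<i>) * fps_X" .
  moreover have "fps_exp \<i> - fps_exp (-\<i>) = fps_const (2 * \<i>) * fps_sin 1"
    using fps_exp_ii_sin_cos[of 1] fps_exp_minus_ii_sin_cos[of 1]
    by (simp add: numeral_fps_const flip: fps_const_mult)
  ultimately have "fps_const (2 * \<i>) * ((S oo (fps_const \<i> * fps_X)) * fps_sin 1) = fps_const (2 * \<i>) * fps_X"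
    by (simp add: mult_ac)
  hence "(S oo (fps_const \<i> * fps_X)) * fps_sin 1 = fps_X"
    by (subst (asm) mult_left_cancel) auto
  moreover have "S oo (fps_const \<i> * fps_X) = fps_X_over_sin"
    by (rule fps_ext) (simp add: S_def B_def fps_X_over_sin_def ring_distribs diff_divide_distrib, simp add: mult_ac)
  ultimately show ?thesis
    by simp
qed

text \<open>A quotient of two odd series is even: substituting \<open>-X\<close> into
  \<open>fps_X_over_sin * fps_sin 1 = fps_X\<close> and cancelling the sine shows invariance under
  \<open>X \<mapsto> -X\<close>.\<close>

lemma fps_X_over_sin_odd:
  assumes "odd n"
  shows   "fps_nth fps_X_over_sin n = 0"
proof -
  have "(fps_X_over_sin oo (-fps_X)) * (fps_sin 1 oo (-fps_X)) = -fps_X"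
    by (simp add: fps_X_over_sin flip: fps_compose_mult_distrib)
  moreover have "fps_sin 1 oo (-fps_X) = -fps_sin (1 :: complex)"
    by (rule fps_ext) (auto simp: fps_compose_uminus' fps_sin_def)
  ultimately have "(fps_X_over_sin oo (-fps_X)) * fps_sin 1 = fps_X_over_sin * fps_sin 1"
    by (simp add: fps_X_over_sin)
  moreover have "fps_sin (1 :: complex) \<noteq> 0"
    using fps_X_over_sin by auto
  ultimately have "fps_X_over_sin oo (-fps_X) = fps_X_over_sin"
    by simp
  hence "fps_nth (fps_X_over_sin oo (-fps_X)) n = fps_nth fps_X_over_sin n"
    by simp
  with assms show ?thesis
    by (simp add: fps_compose_uminus')
qed

text \<open>Since the series is even, it is a series \<open>U\<close> in \<open>X^2\<close>, whose
  \<open>k\<close>-th coefficient is \<open>-((-4)^k)\<close> times the factor in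
  \<open>gamma_coeff\<close>. A product of \<open>m\<close> of these with indices summing to
  \<open>l\<close> carries \<open>(-1)^m (-4)^l\<close>; as \<open>gamma_coeff\<close> already
  contains \<open>(-1)^m 2^l\<close>, the factor \<open>(-2)^l\<close> remains.\<close>

lemma fps_X_over_sin_power_nth:
  "fps_nth (fps_X_over_sin ^ m) n =
     (if even n then of_real ((-2) ^ (n div 2) * gamma_coeff (n div 2) m) else 0)"
proof -
  define U where "U = Abs_fps (\<lambda>k. fps_nth fps_X_over_sin (2 * k))"
  have "fps_X_over_sin = U oo fps_X ^ 2"
    by (rule fps_ext) (auto simp: fps_nth_compose_X_power U_def fps_X_over_sin_odd)
  hence "fps_X_over_sin ^ m = (U ^ m) oo fps_X ^ 2"
    by (simp add: fps_compose_power [symmetric])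
  hence *: "fps_nth (fps_X_over_sin ^ m) n = (if even n then fps_nth (U ^ m) (n div 2) else 0)"
    by (simp add: fps_nth_compose_X_power)
  have U: "fps_nth U k = -((-4) ^ k) *
      of_real ((1 - 2 powi (1 - 2 * int k)) * bernoulli_number (2 * k) / fact (2 * k))" for k
  proof -
    have "(2::complex) powi (1 - 2 * int k) = 2 / 4 ^ k"
      by (simp add: power_int_diff power_int_mult)
    moreover have "(\<i> ^ k) ^ 2 = (-1) ^ k"
      by (metis mult.commute power2_i power_mult)
    moreover have "(2 ^ k) ^ 2 = (4 :: complex) ^ k"
      by (simp add: power2_eq_square flip: power_mult_distrib)
    ultimately have eq: "\<i> ^ (2 * k) * (2 - 2 ^ (2 * k)) = -((-4) ^ k) * (1 - (2::complex) powi (1 - 2 * int k))"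
      by (simp add: power_mult power_even_eq power_minus [of 4] field_simps)
    show ?thesis
      using eq by (simp add: U_def fps_X_over_sin_def of_real_power_int)
  qed
  have "fps_nth (U ^ m) l = of_real ((-2) ^ l * gamma_coeff l m)" for l
  proof -
    have "(\<Prod>j=1..m. fps_nth U (k j)) = (-1) ^ m * (-4) ^ l *
        of_real (\<Prod>j=1..m. (1 - 2 powi (1 - 2 * int (k j))) * bernoulli_number (2 * k j) / fact (2 * k j))"
      if "k \<in> weak_compositions l m" for k
    proof -
      have "(\<Prod>j=1..m. -((-4 :: complex) ^ k j)) = (\<Prod>j=1..m. -1) * (\<Prod>j=1..m. (-4) ^ k j)"
        by (subst prod.distrib [symmetric]) simp
      also have "(\<Prod>j=1..m. (-4 :: complex) ^ k j) = (-4) ^ l"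
        using that by (simp add: weak_compositions_def flip: power_sum)
      finally have "(\<Prod>j=1..m. -((-4 :: complex) ^ k j)) = (-1) ^ m * (-4) ^ l"
        by simp
      thus ?thesis
        by (simp only: U prod.distrib of_real_prod)
    qed
    hence "fps_nth (U ^ m) l = (\<Sum>k\<in>weak_compositions l m. (-1) ^ m * (-4) ^ l *
        of_real (\<Prod>j=1..m. (1 - 2 powi (1 - 2 * int (k j))) * bernoulli_number (2 * k j) / fact (2 * k j)))"
      unfolding fps_power_nth_weak_compositions by (intro sum.cong) auto
    also have "\<dots> = of_real ((-1) ^ m * (-4) ^ l * (\<Sum>k\<in>weak_compositions l m.
        (\<Prod>j=1..m. (1 - 2 powi (1 - 2 * int (k j))) * bernoulli_number (2 * k j) / fact (2 * k j))))"
      by (simp add: sum_distrib_left)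
    also have "(-4 :: real) ^ l = (-2) ^ l * 2 ^ l"
      by (simp flip: power_mult_distrib)
    finally show ?thesis
      by (simp add: gamma_coeff_def mult_ac)
  qed
  thus ?thesis
    by (simp add: *)
qed

section \<open>Residues at the poles\<close>

text \<open>Writing \<open>x + w = x (1 + w / x)\<close> reduces this to the binomial series; a
  positive real factor may be split off a principal power for every \<open>w\<close>.\<close>

lemma has_fps_expansion_powr_shift:
  fixes x a :: real
  assumes "x > 0"
  shows   "(\<lambda>w::complex. (of_real x + w) powr of_real a) has_fps_expansion
             Abs_fps (\<lambda>j. of_real ((a gchoose j) * x powr (a - real j)))"
proof -
  have "((\<lambda>w::complex. (1 + w) powr of_real a) \<circ> (\<lambda>w. of_real (1 / x) * w)) has_fps_expansion
          (fps_binomial (of_real a) oo (fps_const (of_real (1 / x)) * fps_X))"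
    by (intro fps_expansion_intros) auto
  hence "(\<lambda>w::complex. of_real x powr of_real a * (1 + of_real (1 / x) * w) powr of_real a) has_fps_expansion
          (fps_const (of_real x powr of_real a) * (fps_binomial (of_real a) oo (fps_const (of_real (1 / x)) * fps_X)))"
    by (intro fps_expansion_intros) (auto simp: o_def)
  also have "(\<lambda>w::complex. of_real x powr of_real a * (1 + of_real (1 / x) * w) powr of_real a) =
             (\<lambda>w. (of_real x + w) powr of_real a)"
    using assms by (auto simp: fun_eq_iff algebra_simps simp flip: powr_times_real_left)
  also have "fps_const (of_real x powr of_real a) * (fps_binomial (of_real a) oo (fps_const (of_real (1 / x)) * fps_X)) =
             Abs_fps (\<lambda>j. complex_of_real ((a gchoose j) * x powr (a - real j)))"
  proof (rule fps_ext)
    fix j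
    have g: "(complex_of_real a gchoose j) = of_real (a gchoose j)"
      by (simp add: gbinomial_prod_rev of_real_prod)
    have "x powr (a - real j) = x powr a / x ^ j"
      using assms by (simp add: powr_diff powr_realpow)
    thus "fps_nth (fps_const (of_real x powr of_real a) * (fps_binomial (of_real a) oo (fps_const (of_real (1 / x)) * fps_X))) j =
          fps_nth (Abs_fps (\<lambda>j. complex_of_real ((a gchoose j) * x powr (a - real j)))) j"
      using assms by (simp add: powr_of_real power_divide g)
  qed
  finally show ?thesis .
qed

lemma sinh_nonzero_Re:
  fixes z :: complex
  assumes "Re z \<noteq> 0"
  shows   "sinh z \<noteq> 0"
proof
  assume "sinh z = 0"
  hence "exp z = exp (-z)"
    by (simp add: sinh_field_def)
  hence "exp (Re z) = exp (Re (-z))"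
    by (metis norm_exp_eq_Re)
  with assms show False
    by simp
qed

lemma sin_of_nat_pi_plus: "sin (of_real (real n * pi) + w :: complex) = (-1) ^ n * sin w"
proof -
  have "sin (of_real (real n * pi) :: complex) = 0" "cos (of_real (real n * pi) :: complex) = (-1) ^ n"
    by (simp_all only: sin_of_real cos_of_real sin_npi cos_npi) simp_all
  thus ?thesis
    by (simp add: sin_add)
qed

text \<open>At \<open>x + w\<close> the integrand is a product of the binomial series of
  \<open>u^a\<close>, the Taylor series of \<open>1 / sinh^m\<close>, and
  \<open>(-1)^(m n) w^(-m) (w / sin w)^m\<close>. Its residue is therefore the coefficient of index
  \<open>m - 1\<close> in a product of three power series.\<close>

lemma residue_powr_sinh_sin:
  fixes a :: real
  assumes m: "m \<ge> 1" and n: "n \<ge> 1"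
  defines "x \<equiv> real n * pi"
  shows "residue (\<lambda>u. u powr of_real a / (sinh u * sin u) ^ m) (of_real x) =
           (-1) ^ (m * n) * (\<Sum>i\<le>m-1. fps_nth (fps_X_over_sin ^ m) i *
             (\<Sum>j\<le>m-1-i. of_real ((a gchoose j) * x powr (a - real j)) *
                ((deriv ^^ (m-1-i-j)) (\<lambda>u. 1 / sinh u ^ m) (of_real x) / fact (m-1-i-j))))"
proof -
  define A where "A = Abs_fps (\<lambda>j. complex_of_real ((a gchoose j) * x powr (a - real j)))"
  define C where "C = fps_expansion (\<lambda>u::complex. 1 / sinh u ^ m) (of_real x)"
  define S where "S = fps_to_fls (fps_sin (1 :: complex))"
  have x: "x > 0"
    using n by (simp add: x_def)
  have A: "(\<lambda>w::complex. (of_real x + w) powr of_real a) has_laurent_expansion fps_to_fls A"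
    unfolding A_def by (intro has_laurent_expansion_fps has_fps_expansion_powr_shift x)
  have "(\<lambda>u::complex. 1 / sinh u ^ m) analytic_on {of_real x}"
    using sinh_nonzero_Re[of "of_real x"] x
    by (auto intro!: analytic_intros simp: sinh_field_def [abs_def])
  hence C: "(\<lambda>w::complex. 1 / sinh (of_real x + w) ^ m) has_laurent_expansion fps_to_fls C"
    unfolding C_def by (intro has_laurent_expansion_fps analytic_at_imp_has_fps_expansion)
  have S: "fps_to_fls fps_X_over_sin * S = fls_X"
    by (simp add: S_def fps_X_over_sin fls_times_fps_to_fls [symmetric])
  hence S0: "S \<noteq> 0"
    by auto
  have Sinv: "inverse S ^ m = fps_to_fls (fps_X_over_sin ^ m) * fls_X_inv ^ m"
  proof -
    have "fps_to_fls fps_X_over_sin = fls_X / S"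
      using S S0 by (simp add: field_simps)
    hence "inverse S = fps_to_fls fps_X_over_sin * inverse fls_X"
      by (simp add: divide_inverse)
    hence "inverse S = fps_to_fls fps_X_over_sin * fls_X_inv"
      by (simp add: fls_inverse_X)
    thus ?thesis
      by (simp add: power_mult_distrib fps_to_fls_power)
  qed
  have "(\<lambda>w::complex. (-1) ^ (m * n) * ((of_real x + w) powr of_real a * (1 / sinh (of_real x + w) ^ m) *
            inverse (sin w) ^ m)) has_laurent_expansion
          fls_const ((-1) ^ (m * n)) * (fps_to_fls A * fps_to_fls C * inverse S ^ m)"
    unfolding S_def by (intro laurent_expansion_intros A C)
  also have "(\<lambda>w::complex. (-1) ^ (m * n) * ((of_real x + w) powr of_real a * (1 / sinh (of_real x + w) ^ m) *
            inverse (sin w) ^ m)) =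
        (\<lambda>w::complex. (of_real x + w) powr of_real a / (sinh (of_real x + w) * sin (of_real x + w)) ^ m)"
  proof
    fix w :: complex
    \<comment> \<open>The sign of \<open>sin\<close> at the \<open>n\<close>-th pole occurs in the
      denominator; being its own inverse, it may be written as a factor.\<close>
    have "((-1) ^ n) ^ m * ((-1) ^ n) ^ m = (1 :: complex)"
      by (simp flip: power_mult_distrib)
    thus "(-1) ^ (m * n) * ((of_real x + w) powr of_real a * (1 / sinh (of_real x + w) ^ m) *
            inverse (sin w) ^ m) =
          (of_real x + w) powr of_real a / (sinh (of_real x + w) * sin (of_real x + w)) ^ m"
      unfolding x_def sin_of_nat_pi_plus
      by (simp add: power_mult_distrib power_mult mult.commute [of m n] divide_simps power_inverse)
  qed
  finally have "residue (\<lambda>u. u powr of_real a / (sinh u * sin u) ^ m) (of_real x) =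
        fls_residue (fls_const ((-1) ^ (m * n)) * (fps_to_fls A * fps_to_fls C * inverse S ^ m))"
    by (rule has_laurent_expansion_residue)
  also have "fps_to_fls A * fps_to_fls C * inverse S ^ m =
             fps_to_fls (fps_X_over_sin ^ m * (A * C)) * fls_X_inv ^ m"
    unfolding Sinv by (simp add: fls_times_fps_to_fls mult_ac)
  also have "fls_residue (fls_const ((-1) ^ (m * n)) * \<dots>) =
             (-1) ^ (m * n) * fps_nth (fps_X_over_sin ^ m * (A * C)) (m - 1)"
    using m by (simp add: fls_X_inv_power_times_conv_shift nat_diff_distrib of_nat_diff)
  also have "fps_nth (fps_X_over_sin ^ m * (A * C)) (m - 1) =
     (\<Sum>i\<le>m-1. fps_nth (fps_X_over_sin ^ m) i *
             (\<Sum>j\<le>m-1-i. of_real ((a gchoose j) * x powr (a - real j)) *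
                ((deriv ^^ (m-1-i-j)) (\<lambda>u. 1 / sinh u ^ m) (of_real x) / fact (m-1-i-j))))"
    by (simp add: fps_mult_nth A_def C_def fps_expansion_def atLeast0AtMost)
  finally show ?thesis .
qed

section \<open>The hyperbolic series as a holomorphic function\<close>

lemma norm_sinh_ge: "sinh (Re z) \<le> norm (sinh (z :: complex))"
proof -
  have "exp (Re z) - exp (-Re z) \<le> norm (exp z - exp (-z))"
    using norm_triangle_ineq2[of "exp z" "exp (-z)"] by simp
  thus ?thesis
    by (simp add: sinh_field_def norm_divide)
qed

lemma summable_powr_div_sinh_power:
  fixes s d :: real
  assumes "d > 0" "m \<ge> 1"
  shows   "summable (\<lambda>n. real (Suc n) powr s / sinh (real (Suc n) * d) ^ m)"
proof -
  \<comment> \<open>\<open>sinh t = exp t * (1 - exp (-2 t)) / 2\<close>, and for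
    \<open>t = n d\<close> with \<open>n \<ge> 1\<close> the bracket is at least its value at
    \<open>t = d\<close>. So each term is dominated by a power times an exponential.\<close>
  define c where "c = (1 - exp (-2 * d)) / 2"
  define e where "e = d * real m"
  have c: "c > 0" and e: "e > 0"
    using assms by (auto simp: c_def e_def)
  have bound: "norm (real (Suc n) powr s / sinh (real (Suc n) * d) ^ m) \<le>
                 inverse (c ^ m) * (real (Suc n) powr s * exp (- (e * real (Suc n))))" for n
  proof -
    have "exp (-2 * real (Suc n) * d) \<le> exp (-2 * d)"
      using mult_right_mono[of 1 "real (Suc n)" d] assms by (simp add: algebra_simps)
    hence "c * exp (real (Suc n) * d) \<le> (1 - exp (-2 * real (Suc n) * d)) / 2 * exp (real (Suc n) * d)"
      by (intro mult_right_mono) (auto simp: c_def)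
    also have "\<dots> = sinh (real (Suc n) * d)"
      by (simp add: sinh_field_def left_diff_distrib flip: exp_add) (simp add: algebra_simps)
    finally have *: "c * exp (real (Suc n) * d) \<le> sinh (real (Suc n) * d)" .
    moreover have "0 < c * exp (real (Suc n) * d)"
      using c by simp
    ultimately have "0 < sinh (real (Suc n) * d)"
      by linarith
    hence "real (Suc n) powr s / sinh (real (Suc n) * d) ^ m \<le>
          real (Suc n) powr s / (c * exp (real (Suc n) * d)) ^ m"
      using c by (intro divide_left_mono power_mono mult_pos_pos zero_less_power *) auto
    also have "\<dots> = inverse (c ^ m) * (real (Suc n) powr s * exp (- (e * real (Suc n))))"
      by (simp add: e_def power_mult_distrib exp_minus divide_simps mult_ac flip: exp_of_nat_mult)
    finally show ?thesis
      using assms by simp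
  qed
  have "(\<lambda>n. real (Suc n) powr s * exp (- (e * real (Suc n)))) \<in> O(\<lambda>n. 1 / real n ^ 2)"
    using e by real_asymp
  hence "summable (\<lambda>n. real (Suc n) powr s * exp (- (e * real (Suc n))))"
    by (rule summable_comparison_test_bigo[rotated]) (simp add: inverse_power_summable flip: inverse_eq_divide)
  hence "summable (\<lambda>n. inverse (c ^ m) * (real (Suc n) powr s * exp (- (e * real (Suc n)))))"
    by (rule summable_mult)
  thus ?thesis
    by (rule summable_comparison_test'[where N = 0]) (use bound in auto)
qed

text \<open>The extension of \<open>sinh_term\<close> to complex \<open>y\<close>, where termwise
  differentiation is available.\<close>

definition csinh_term :: "nat \<Rightarrow> real \<Rightarrow> nat \<Rightarrow> complex \<Rightarrow> complex" where
  "csinh_term m s n y = (-1) ^ (m * Suc n) * of_real (real (Suc n) powr s) / sinh (of_nat (Suc n) * y) ^ m"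

definition csinh_series :: "nat \<Rightarrow> real \<Rightarrow> complex \<Rightarrow> complex" where
  "csinh_series m s y = (\<Sum>n. csinh_term m s n y)"

lemma holomorphic_inverse_sinh_power: "(\<lambda>u. 1 / sinh u ^ m) holomorphic_on {z::complex. Re z > 0}"
  using sinh_nonzero_Re
  by (auto intro!: holomorphic_intros simp: sinh_field_def [abs_def] less_imp_neq [symmetric])

lemma holomorphic_csinh_term: "csinh_term m s n holomorphic_on {z. Re z > 0}"
proof -
  have "(\<lambda>u. 1 / sinh u ^ m) \<circ> (\<lambda>y. of_nat (Suc n) * y) holomorphic_on {z. Re z > 0}"
    by (rule holomorphic_on_compose_gen[OF _ holomorphic_inverse_sinh_power])
       (auto intro!: holomorphic_intros simp del: of_nat_Suc)
  hence "(\<lambda>y. (-1) ^ (m * Suc n) * of_real (real (Suc n) powr s) * 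
           ((\<lambda>u. 1 / sinh u ^ m) \<circ> (\<lambda>y. of_nat (Suc n) * y)) y) holomorphic_on {z. Re z > 0}"
    by (intro holomorphic_intros)
  thus ?thesis
    by (simp add: csinh_term_def [abs_def] o_def)
qed

text \<open>Every derivative in \<open>y\<close> brings out one inner factor \<open>Suc n\<close>;
  this is what shifts the exponent from \<open>s\<close> to \<open>s + k\<close>.\<close>

lemma higher_deriv_csinh_term:
  assumes "Re y > 0"
  shows "(deriv ^^ k) (csinh_term m s n) y = (-1) ^ (m * Suc n) * of_real (real (Suc n) powr (s + real k)) *
           (deriv ^^ k) (\<lambda>u. 1 / sinh u ^ m) (of_nat (Suc n) * y)"
proof -
  have opn: "open {z. Re z > 0}"
    by (rule open_halfspace_Re_gt)
  have holo: "(\<lambda>y. 1 / sinh (of_nat (Suc n) * y) ^ m) holomorphic_on {z. Re z > 0}"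
    by (rule holomorphic_on_compose_gen[OF _ holomorphic_inverse_sinh_power, unfolded o_def])
       (auto intro!: holomorphic_intros simp del: of_nat_Suc)
  have "csinh_term m s n = (\<lambda>y. ((-1) ^ (m * Suc n) * of_real (real (Suc n) powr s)) *
          (1 / sinh (of_nat (Suc n) * y) ^ m))"
    by (simp add: csinh_term_def fun_eq_iff)
  hence "(deriv ^^ k) (csinh_term m s n) y = (deriv ^^ k) (\<lambda>y. ((-1) ^ (m * Suc n) * of_real (real (Suc n) powr s)) *
          (1 / sinh (of_nat (Suc n) * y) ^ m)) y"
    by simp
  also have "\<dots> = ((-1) ^ (m * Suc n) * of_real (real (Suc n) powr s)) *
          (deriv ^^ k) (\<lambda>y. 1 / sinh (of_nat (Suc n) * y) ^ m) y"
    using assms by (intro higher_deriv_cmult[OF holo _ opn]) auto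
  also have "(deriv ^^ k) (\<lambda>y. 1 / sinh (of_nat (Suc n) * y) ^ m) y =
             of_nat (Suc n) ^ k * (deriv ^^ k) (\<lambda>u. 1 / sinh u ^ m) (of_nat (Suc n) * y)"
    using assms by (intro higher_deriv_compose_linear[OF holomorphic_inverse_sinh_power opn opn])
                   (auto simp del: of_nat_Suc)
  finally show ?thesis
    by (simp add: powr_add powr_realpow del: of_nat_Suc)
qed

text \<open>On \<open>Re z > d\<close> each term is dominated by its absolute value at the real
  point \<open>d\<close>, because \<open>norm (sinh z) \<ge> sinh (Re z)\<close> and the real
  \<open>sinh\<close> is increasing.\<close>

lemma uniform_limit_csinh_series:
  assumes "d > 0" "m \<ge> 1"
  shows   "uniform_limit {z. Re z > d} (\<lambda>n y. \<Sum>i<n. csinh_term m s i y) (csinh_series m s) sequentially"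
  unfolding csinh_series_def [abs_def]
proof (rule Weierstrass_m_test)
  show "summable (\<lambda>n. real (Suc n) powr s / sinh (real (Suc n) * d) ^ m)"
    using assms by (rule summable_powr_div_sinh_power)
  fix n y assume y: "y \<in> {z. Re z > d}"
  have "sinh (real (Suc n) * d) \<le> sinh (Re (of_nat (Suc n) * y))"
    using y by (simp del: of_nat_Suc)
  also have "\<dots> \<le> norm (sinh (of_nat (Suc n) * y))"
    by (rule norm_sinh_ge)
  finally have *: "sinh (real (Suc n) * d) \<le> norm (sinh (of_nat (Suc n) * y))" .
  have pos: "sinh (real (Suc n) * d) > 0"
    using assms by simp
  show "norm (csinh_term m s n y) \<le> real (Suc n) powr s / sinh (real (Suc n) * d) ^ m"
    unfolding csinh_term_def norm_mult norm_divide norm_power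
    using * pos by (auto intro!: divide_left_mono power_mono mult_pos_pos zero_less_power
                      less_le_trans[OF pos *] simp del: of_nat_Suc)
qed

lemma higher_deriv_csinh_series:
  assumes "m \<ge> 1" "Re y > 0"
  shows "(\<lambda>n. (deriv ^^ k) (csinh_term m s n) y) sums (deriv ^^ k) (csinh_series m s) y"
proof -
  \<comment> \<open>A neighbourhood of \<open>y\<close> that keeps a positive distance from the
    imaginary axis, as uniform convergence requires.\<close>
  define S where "S = {z. Re z > Re y / 2}"
  have "open S"
    unfolding S_def by (rule open_halfspace_Re_gt)
  with assms have S: "open S" "y \<in> S" "S \<subseteq> {z. Re z > 0}"
    using assms unfolding S_def by (auto intro!: open_halfspace_Re_gt simp del: less_divide_eq_numeral1)
  have holo: "csinh_term m s i holomorphic_on S" for i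
    using holomorphic_csinh_term S(3) by (rule holomorphic_on_subset)
  have "(\<lambda>n. (deriv ^^ k) (\<lambda>y. \<Sum>i<n. csinh_term m s i y) y) \<longlonglongrightarrow> (deriv ^^ k) (csinh_series m s) y"
  proof (rule higher_deriv_complex_uniform_limit)
    show "uniform_limit S (\<lambda>n y. \<Sum>i<n. csinh_term m s i y) (csinh_series m s) sequentially"
      unfolding S_def using assms by (intro uniform_limit_csinh_series) auto
    show "\<forall>\<^sub>F n in sequentially. (\<lambda>y. \<Sum>i<n. csinh_term m s i y) holomorphic_on S"
      using holo by (intro always_eventually allI holomorphic_intros)
  qed (use S in auto)
  also have "(\<lambda>n. (deriv ^^ k) (\<lambda>y. \<Sum>i<n. csinh_term m s i y) y) = 
             (\<lambda>n. \<Sum>i<n. (deriv ^^ k) (csinh_term m s i) y)"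
  proof
    fix n
    show "(deriv ^^ k) (\<lambda>y. \<Sum>i<n. csinh_term m s i y) y = (\<Sum>i<n. (deriv ^^ k) (csinh_term m s i) y)"
    proof (induction n)
      case (Suc n)
      have "(deriv ^^ k) (\<lambda>y. (\<Sum>i<n. csinh_term m s i y) + csinh_term m s n y) y =
            (deriv ^^ k) (\<lambda>y. \<Sum>i<n. csinh_term m s i y) y + (deriv ^^ k) (csinh_term m s n) y"
        using S by (intro higher_deriv_add[of _ S] holomorphic_intros holo) auto
      thus ?case
        by (simp add: Suc.IH)
    qed (use higher_deriv_const[of k "0::complex"] in auto)
  qed
  finally show ?thesis
    by (simp add: sums_def)
qed

lemma holomorphic_csinh_series:
  assumes "m \<ge> 1"
  shows   "csinh_series m s holomorphic_on {z. Re z > 0}"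
proof (rule holomorphic_uniform_sequence)
  show "open {z. Re z > 0}"
    by (rule open_halfspace_Re_gt)
  show "(\<lambda>y. \<Sum>i<n. csinh_term m s i y) holomorphic_on {z. Re z > 0}" for n
    by (intro holomorphic_intros holomorphic_csinh_term)
  fix y assume "y \<in> {z. Re z > 0}"
  hence y: "Re y > 0" by simp
  \<comment> \<open>The radius \<open>Re y / 3\<close> is below \<open>Re y / 2\<close>, so even the
    closed disc stays in the half-plane of uniform convergence.\<close>
  have *: "cball y (Re y / 3) \<subseteq> {z. Re z > Re y / 2}"
  proof
    fix z assume "z \<in> cball y (Re y / 3)"
    moreover have "\<bar>Re (y - z)\<bar> \<le> dist y z"
      unfolding dist_norm by (rule abs_Re_le_cmod)
    ultimately show "z \<in> {z. Re z > Re y / 2}"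
      using y by auto
  qed
  have "uniform_limit {z. Re z > Re y / 2} (\<lambda>n y. \<Sum>i<n. csinh_term m s i y) (csinh_series m s) sequentially"
    using y assms by (intro uniform_limit_csinh_series) auto
  hence "uniform_limit (cball y (Re y / 3)) (\<lambda>n y. \<Sum>i<n. csinh_term m s i y) (csinh_series m s) sequentially"
    using * by (rule uniform_limit_on_subset)
  moreover have "cball y (Re y / 3) \<subseteq> {z. Re z > 0}"
    using * y by force
  ultimately show "\<exists>d>0. cball y d \<subseteq> {z. Re z > 0} \<and> uniform_limit (cball y d) 
      (\<lambda>n y. \<Sum>i<n. csinh_term m s i y) (csinh_series m s) sequentially"
    using y by (intro exI[of _ "Re y / 3"]) auto
qed

section \<open>Restriction to the real axis\<close>

lemma csinh_term_of_real: "csinh_term m s n (of_real y) = of_real (sinh_term m s y n)"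
proof -
  have "sinh (of_nat (Suc n) * complex_of_real y) = of_real (sinh (real (Suc n) * y))"
    by (simp add: sinh_field_def flip: exp_of_real)
  thus ?thesis
    by (simp add: csinh_term_def sinh_term_def del: of_nat_Suc)
qed

lemma summable_sinh_term:
  assumes "m \<ge> 1" "y > 0"
  shows   "summable (sinh_term m s y)"
  by (rule summable_comparison_test'[OF summable_powr_div_sinh_power[OF assms(2,1), of s], where N = 0])
     (use assms in \<open>simp add: sinh_term_def norm_mult norm_power abs_mult power_abs del: of_nat_Suc\<close>)

lemma csinh_series_of_real:
  assumes "m \<ge> 1" "y > 0"
  shows   "csinh_series m s (of_real y) = of_real (sinh_series m s y)"
  using summable_sinh_term[OF assms]
  by (simp add: csinh_series_def sinh_series_def csinh_term_of_real suminf_of_real)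

text \<open>Along the real axis the complex derivative is the vector derivative of the restriction.
  The imaginary part of the restriction is 0, so the derivative is real and coincides with that of
  \<open>f\<close>.\<close>

lemma real_deriv_of_holomorphic:
  fixes f :: "real \<Rightarrow> real" and F :: "complex \<Rightarrow> complex"
  assumes holo: "F holomorphic_on S" and S: "open S" "of_real ` T \<subseteq> S" and T: "open T" "y \<in> T"
    and eq: "\<And>y. y \<in> T \<Longrightarrow> F (of_real y) = of_real (f y)"
  shows "(f has_real_derivative Re (deriv F (of_real y))) (at y)"
    and "deriv F (of_real y) = of_real (deriv f y)"
proof -
  have "of_real y \<in> S"
    using S(2) T(2) by auto
  hence "(F has_field_derivative deriv F (of_real y)) (at (of_real y))"
    using holo S(1) by (intro holomorphic_derivI) auto
  hence "((\<lambda>x. F (of_real x)) has_vector_derivative deriv F (of_real y)) (at y)"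
    by (rule has_vector_derivative_real_field)
  hence *: "((\<lambda>x. complex_of_real (f x)) has_vector_derivative deriv F (of_real y)) (at y)"
    using T by (rule has_vector_derivative_transform_within_open) (use eq in auto)
  have "((\<lambda>x. Re (complex_of_real (f x))) has_vector_derivative Re (deriv F (of_real y))) (at y)"
    by (rule bounded_linear.has_vector_derivative[OF bounded_linear_Re *])
  thus D: "(f has_real_derivative Re (deriv F (of_real y))) (at y)"
    by (simp add: has_real_derivative_iff_has_vector_derivative)
  have "((\<lambda>x. Im (complex_of_real (f x))) has_vector_derivative Im (deriv F (of_real y))) (at y)"
    by (rule bounded_linear.has_vector_derivative[OF bounded_linear_Im *])
  hence "((\<lambda>x::real. 0::real) has_real_derivative Im (deriv F (of_real y))) (at y)"
    by (simp add: has_real_derivative_iff_has_vector_derivative)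
  hence "Im (deriv F (of_real y)) = 0"
    using DERIV_const DERIV_unique by blast
  thus "deriv F (of_real y) = of_real (deriv f y)"
    using DERIV_imp_deriv[OF D] by (simp add: complex_eq_iff)
qed

text \<open>The induction carries the identity on the whole open set \<open>T\<close>:
  differentiating once more at \<open>y\<close> uses it in a neighbourhood of
  \<open>y\<close>.\<close>

lemma higher_deriv_of_real:
  fixes f :: "real \<Rightarrow> real" and F :: "complex \<Rightarrow> complex"
  assumes holo: "F holomorphic_on S" and S: "open S" "of_real ` T \<subseteq> S" and T: "open T" "y \<in> T"
    and eq: "\<And>y. y \<in> T \<Longrightarrow> F (of_real y) = of_real (f y)"
  shows "(deriv ^^ k) F (of_real y) = of_real ((deriv ^^ k) f y)"
  using T(2)
proof (induction k arbitrary: y)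
  case 0
  thus ?case by (simp add: eq)
next
  case (Suc k)
  have "(deriv ^^ k) F holomorphic_on S"
    using holo S(1) by (intro holomorphic_higher_deriv)
  from real_deriv_of_holomorphic(2)[OF this S T(1) Suc.prems Suc.IH] show ?case
    by simp
qed

lemma differentiable_higher_deriv_of_real:
  fixes f :: "real \<Rightarrow> real" and F :: "complex \<Rightarrow> complex"
  assumes holo: "F holomorphic_on S" and S: "open S" "of_real ` T \<subseteq> S" and T: "open T" "y \<in> T"
    and eq: "\<And>y. y \<in> T \<Longrightarrow> F (of_real y) = of_real (f y)"
  shows "(deriv ^^ k) f differentiable at y"
proof -
  have "(deriv ^^ k) F holomorphic_on S"
    using holo S(1) by (intro holomorphic_higher_deriv)
  from real_deriv_of_holomorphic(1)[OF this S T higher_deriv_of_real[OF holo S T(1) _ eq]]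
  show ?thesis
    by (auto simp: real_differentiable_def)
qed

lemma higher_deriv_sinh_series:
  assumes m: "m \<ge> 1" and "y > 0"
  shows "of_real ((deriv ^^ k) (sinh_series m s) y) = (deriv ^^ k) (csinh_series m s) (of_real y)"
    and "(deriv ^^ k) (sinh_series m s) differentiable at y"
proof -
  have opn: "open {z. Re z > 0}"
    by (rule open_halfspace_Re_gt)
  note * = holomorphic_csinh_series[OF m] opn _ open_greaterThan[of "0::real"] _ csinh_series_of_real[OF m]
  show "of_real ((deriv ^^ k) (sinh_series m s) y) = (deriv ^^ k) (csinh_series m s) (of_real y)"
    by (rule higher_deriv_of_real[OF *, symmetric]) (use assms in auto)
  show "(deriv ^^ k) (sinh_series m s) differentiable at y"
    by (rule differentiable_higher_deriv_of_real[OF *]) (use assms in auto)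
qed

lemma tendsto_higher_deriv_sinh_series:
  assumes "m \<ge> 1"
  shows "((deriv ^^ k) (sinh_series m s) \<longlongrightarrow> (deriv ^^ k) (sinh_series m s) pi) (at pi)"
  using differentiable_imp_continuous_within[OF higher_deriv_sinh_series(2)[OF assms, of pi k]]
  by (simp add: continuous_within)

lemma Lim_higher_deriv_sinh_series:
  assumes "m \<ge> 1"
  shows "Lim (at pi) ((deriv ^^ k) (sinh_series m s)) = (deriv ^^ k) (sinh_series m s) pi"
  by (intro tendsto_Lim tendsto_higher_deriv_sinh_series assms) auto

section \<open>Estimates in the sector\<close>

text \<open>Shows the two ways in which \<open>sin z\<close> stays away from 0: a large imaginary
  part (used on the rays), or a real part half-way between multiples of \<pi> (used on the vertical
  side). It also forces the zeros of \<open>sin\<close> to be real.\<close>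

lemma norm_sin_sq: "norm (sin z) ^ 2 = sin (Re z) ^ 2 + sinh (Im z) ^ 2" for z :: complex
proof -
  have "norm (sin z) ^ 2 = (sin (Re z) * cosh (Im z)) ^ 2 + (cos (Re z) * sinh (Im z)) ^ 2"
    unfolding cmod_power2 Re_sin Im_sin by (simp add: cosh_field_def sinh_field_def)
  also have "\<dots> = sin (Re z) ^ 2 * (1 + sinh (Im z) ^ 2) + (1 - sin (Re z) ^ 2) * sinh (Im z) ^ 2"
    unfolding power_mult_distrib cosh_square_eq cos_squared_eq by (simp only: add.commute)
  finally show ?thesis
    by (simp add: algebra_simps)
qed

lemma norm_sin_ge_sinh: "sinh \<bar>Im z\<bar> \<le> norm (sin z)" for z :: complex
  by (rule power2_le_imp_le) (auto simp: norm_sin_sq sinh_real_abs)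

lemma sinh_real_ge:
  fixes x :: real
  assumes "x \<ge> 0"
  shows   "x \<le> sinh x"
proof -
  have "sinh 0 - 0 \<le> sinh x - x"
  proof (rule DERIV_nonneg_imp_nondecreasing[OF assms])
    fix t :: real
    show "\<exists>y. ((\<lambda>x. sinh x - x) has_real_derivative y) (at t) \<and> 0 \<le> y"
      by (rule exI[of _ "cosh t - 1"]) (auto intro!: derivative_eq_intros simp: cosh_real_ge_1)
  qed
  thus ?thesis by simp
qed

lemma sin_ge_half:
  fixes x :: real
  assumes "x \<ge> 0" "x \<le> 1"
  shows   "x / 2 \<le> sin x"
proof -
  have "sin 0 - 0 / 2 \<le> sin x - x / 2"
  proof (rule DERIV_nonneg_imp_nondecreasing[OF assms(1)])
    fix t assume "0 \<le> t" "t \<le> x"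
    \<comment> \<open>\<open>1 < pi / 3\<close>, so the cosine is at least
      \<open>cos (pi / 3) = 1/2\<close> on the interval.\<close>
    hence "cos (pi / 3) \<le> cos t"
      using assms pi_gt3 by (subst cos_mono_le_eq) auto
    hence "1 / 2 \<le> cos t"
      by (simp add: cos_60)
    thus "\<exists>y. ((\<lambda>x. sin x - x / 2) has_real_derivative y) (at t) \<and> 0 \<le> y"
      by (intro exI[of _ "cos t - 1 / 2"]) (auto intro!: derivative_eq_intros)
  qed
  thus ?thesis by simp
qed

lemma norm_sin_ge_half:
  fixes u :: complex
  assumes "\<bar>Re u\<bar> \<le> 1"
  shows   "norm u / 2 \<le> norm (sin u)"
proof (rule power2_le_imp_le)
  have "(\<bar>Re u\<bar> / 2) ^ 2 \<le> (sin \<bar>Re u\<bar>) ^ 2"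
    using assms by (intro power_mono sin_ge_half) auto
  moreover have "\<bar>Im u\<bar> / 2 \<le> sinh \<bar>Im u\<bar>"
    using sinh_real_ge[of "\<bar>Im u\<bar>"] by linarith
  hence "(\<bar>Im u\<bar> / 2) ^ 2 \<le> sinh \<bar>Im u\<bar> ^ 2"
    by (intro power_mono) auto
  moreover have "(sin \<bar>Re u\<bar>) ^ 2 = sin (Re u) ^ 2" "sinh \<bar>Im u\<bar> ^ 2 = sinh (Im u) ^ 2"
    by (auto simp: abs_if)
  ultimately show "(norm u / 2) ^ 2 \<le> norm (sin u) ^ 2"
    using cmod_power2[of u] by (simp add: norm_sin_sq power_divide)
qed auto

lemma norm_sinh_ge_half:
  fixes u :: complex
  assumes "\<bar>Im u\<bar> \<le> 1"
  shows   "norm u / 2 \<le> norm (sinh u)"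
  using norm_sin_ge_half[of "\<i> * u"] assms by (simp add: sinh_conv_sin norm_mult)

definition berndt_fun :: "nat \<Rightarrow> real \<Rightarrow> complex \<Rightarrow> complex" where
  "berndt_fun m a u = u powr of_real a / (sinh u * sin u) ^ m"

text \<open>
  The hypotheses on \<open>u\<close> describe a neighbourhood of the rays inside the sector that contains every shifted
  ray \<open>e + t (1 \<plusminus> \<i>)\<close> with \<open>e \<le> 1/2\<close>; near \<open>0\<close> the bound needs \<open>a \<ge> 2 m\<close>. The triangles have their apex at
  such an \<open>e > 0\<close>, because the function is not holomorphic at \<open>0\<close>.
\<close>

lemma norm_berndt_fun_le:
  fixes u :: complex
  assumes m: "m \<ge> 1" and a: "a \<ge> 2 * real m"
    and u: "0 < Re u" "\<bar>Im u\<bar> \<le> Re u" "Re u \<le> \<bar>Im u\<bar> + 1/2"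
  shows "norm (berndt_fun m a u) \<le> 8 ^ m * 2 powr a * 3 * (2 * a) powr a * exp (- Re u / 2)"
proof -
  define x where "x = Re u"
  have x: "x > 0"
    using u by (simp add: x_def)
  have a_pos: "a \<ge> 2"
    using m a by linarith
  have u0: "u \<noteq> 0" and nu: "0 < norm u" "norm u \<le> 2 * x" 
    using u cmod_le[of u] by (auto simp: x_def complex_eq_iff)
  have norm: "norm (berndt_fun m a u) = norm u powr a / (norm (sinh u) * norm (sin u)) ^ m"
    by (simp add: berndt_fun_def norm_divide norm_mult norm_power norm_powr_real_powr')
  \<comment> \<open>For \<open>x \<le> 1\<close> both \<open>sin\<close> and \<open>sinh\<close> are
    compared with \<open>norm u / 2\<close>, and 3 absorbs \<open>exp x\<close>. For
    \<open>x > 1\<close> the sine is at least \<open>1/2\<close> and \<open>sinh\<close> at least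
    \<open>exp x / 4\<close>, whence \<open>8^m\<close>. The factor \<open>2 powr a\<close> comes
    from \<open>norm u \<le> 2 * x\<close>.\<close>
  have "norm (berndt_fun m a u) \<le> 8 ^ m * 2 powr a * 3 * ((1 + x) powr a * exp (-x))"
  proof (cases "x \<le> 1")
    case True
    have *: "norm u / 2 \<le> norm (sinh u)" "norm u / 2 \<le> norm (sin u)"
      using True u by (intro norm_sin_ge_half norm_sinh_ge_half; simp add: x_def)+
    have "norm (berndt_fun m a u) \<le> norm u powr a / (norm u / 2 * (norm u / 2)) ^ m"
      unfolding norm using nu u0
      by (intro divide_left_mono power_mono mult_mono * mult_pos_pos zero_less_power)
         (use * nu in auto)
    also have "(norm u / 2 * (norm u / 2)) ^ m = norm u powr (2 * real m) / 4 ^ m"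
    proof -
      have *: "norm u powr (2 * real m) = (norm u ^ 2) ^ m"
        using powr_realpow[of "norm u" "2 * m"] nu by (simp add: power_mult)
      have **: "norm u / 2 * (norm u / 2) = norm u ^ 2 / 4"
        by (simp add: power2_eq_square)
      show ?thesis
        unfolding * ** by (simp add: power_divide)
    qed
    also have "norm u powr a / (norm u powr (2 * real m) / 4 ^ m) = 4 ^ m * norm u powr (a - 2 * real m)"
      using nu by (simp add: powr_diff)
    also have "\<dots> \<le> 8 ^ m * (2 powr a * (3 * ((1 + x) powr a * exp (-x))))"
    proof (intro mult_mono)
      show "(4 :: real) ^ m \<le> 8 ^ m"
        by (intro power_mono) auto
      \<comment> \<open>The exponent is nonnegative by \<open>a \<ge> 2 * real m\<close>, so the
        zero of the numerator at 0 compensates the zero of order \<open>2 m\<close> of the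
        denominator.\<close>
      have "norm u powr (a - 2 * real m) \<le> 2 powr (a - 2 * real m)"
        using nu True a by (intro powr_mono2) auto
      also have "\<dots> \<le> 2 powr a"
        by (intro powr_mono) auto
      also have "2 powr a \<le> 2 powr a * (3 * ((1 + x) powr a * exp (-x)))"
      proof -
        have "exp x \<le> exp 1"
          using True by simp
        also have "\<dots> \<le> (3 :: real)"
          using exp_le by simp
        finally have "1 \<le> 3 * exp (-x)"
          by (simp add: exp_minus field_simps)
        moreover have "1 \<le> (1 + x) powr a"
          using x a_pos by (intro ge_one_powr_ge_zero) auto
        ultimately have "1 * 1 \<le> (3 * exp (-x)) * (1 + x) powr a"
          by (intro mult_mono) auto
        thus ?thesis
          by (simp add: mult_ac)
      qed
      finally show "norm u powr (a - 2 * real m) \<le> 2 powr a * (3 * ((1 + x) powr a * exp (-x)))" .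
    qed auto
    finally show ?thesis
      by (simp add: mult_ac)
  next
    case False
    \<comment> \<open>This is where closeness to the rays enters: beyond \<open>Re u = 1\<close> the
      imaginary part keeps \<open>u\<close> away from the real zeros of \<open>sin\<close>.\<close>
    have "1/2 \<le> \<bar>Im u\<bar>"
      using False u by (auto simp: x_def)
    also have "\<dots> \<le> sinh \<bar>Im u\<bar>"
      by (rule sinh_real_ge) auto
    also have "\<dots> \<le> norm (sin u)"
      by (rule norm_sin_ge_sinh)
    finally have 1: "1/2 \<le> norm (sin u)" .
    have "2 \<le> exp x"
      using exp_ge_add_one_self[of x] False by linarith
    moreover have "exp (-x) \<le> 1"
      using x by simp
    ultimately have "2 * exp (-x) \<le> exp x"
      by linarith
    hence "exp x / 4 \<le> sinh x"
      by (simp add: sinh_field_def)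
    also have "\<dots> \<le> norm (sinh u)"
      unfolding x_def by (rule norm_sinh_ge)
    finally have 2: "exp x / 4 \<le> norm (sinh u)" .
    have pos: "0 < norm (sin u)" "0 < norm (sinh u)"
      using 1 2 exp_gt_zero[of x] by linarith+
    have "norm (berndt_fun m a u) \<le> (2 * x) powr a / (exp x / 4 * (1/2)) ^ m"
    proof -
      have "norm u powr a \<le> (2 * x) powr a"
        using nu a_pos by (intro powr_mono2) linarith+
      moreover have "exp x / 4 * (1/2) \<le> norm (sinh u) * norm (sin u)"
        using 1 2 by (rule_tac mult_mono) (simp_all add: pos[THEN less_imp_le])
      hence "(exp x / 4 * (1/2)) ^ m \<le> (norm (sinh u) * norm (sin u)) ^ m"
        by (rule power_mono) simp
      ultimately show ?thesis
        unfolding norm by (intro frac_le) simp_all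
    qed
    also have "\<dots> = 8 ^ m * 2 powr a * (x powr a * (1 / exp x ^ m))"
      using x by (simp add: powr_mult power_divide power_mult_distrib)
    also have "\<dots> \<le> 8 ^ m * 2 powr a * (3 * ((1 + x) powr a * exp (-x)))"
    proof (intro mult_left_mono)
      have "exp x ^ 1 \<le> exp x ^ m"
        using m x by (intro power_increasing) auto
      hence "1 / exp x ^ m \<le> exp (-x)"
        by (simp add: exp_minus field_simps)
      moreover have "x powr a \<le> (1 + x) powr a"
        using x a_pos by (intro powr_mono2) linarith+
      ultimately have "x powr a * (1 / exp x ^ m) \<le> (1 + x) powr a * exp (-x)"
        by (intro mult_mono) simp_all
      also have "\<dots> \<le> 3 * \<dots>"
        by simp
      finally show "x powr a * (1 / exp x ^ m) \<le> 3 * ((1 + x) powr a * exp (-x))" .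
    qed auto
    finally show ?thesis
      by (simp add: mult_ac)
  qed
  also have "\<dots> \<le> 8 ^ m * 2 powr a * 3 * ((2 * a) powr a * exp (-x / 2))"
  proof (intro mult_left_mono)
    \<comment> \<open>Scaling by \<open>2 * a\<close> makes the \<open>a\<close>-th power of the
      exponential equal to \<open>exp (x / 2)\<close>, so the polynomial growth uses up only half of
      the decay \<open>exp (-x)\<close>.\<close>
    have "1 + x \<le> 2 * a * (1 + x / (2 * a))"
      using a_pos x by (simp add: field_simps)
    also have "\<dots> \<le> 2 * a * exp (x / (2 * a))"
      using a_pos exp_ge_add_one_self[of "x / (2 * a)"] by (intro mult_left_mono) auto
    finally have "(1 + x) powr a \<le> (2 * a * exp (x / (2 * a))) powr a"
      using x a_pos by (intro powr_mono2) auto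
    also have "\<dots> = (2 * a) powr a * exp (x / (2 * a)) powr a"
      using a_pos by (intro powr_mult)
    also have "exp (x / (2 * a)) powr a = exp (x / 2)"
      using a_pos by (simp add: powr_def)
    finally have "(1 + x) powr a * exp (-x) \<le> (2 * a) powr a * exp (x / 2) * exp (-x)"
      by (intro mult_right_mono) auto
    thus "(1 + x) powr a * exp (-x) \<le> (2 * a) powr a * exp (-x / 2)"
      by (simp add: mult.assoc flip: exp_add)
  qed auto
  finally show ?thesis
    by (simp add: x_def mult_ac)
qed

section \<open>The integrand on the two rays\<close>

lemma cos_minus_cosh_factor:
  fixes u :: complex
  shows "cos ((1 + \<i>) * u) - cosh ((1 + \<i>) * u) = -2 * \<i> * (sinh u * sin u)"
proof -
  \<comment> \<open>With \<open>cosh z = cos (\<i> z)\<close> the difference has a sum-to-product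
    form; for \<open>z = (1 + \<i>) u\<close> the half-sum and half-difference of the arguments are
    \<open>\<i> u\<close> and \<open>-u\<close>.\<close>
  have "cos ((1 + \<i>) * u) - cosh ((1 + \<i>) * u) = cos ((1 + \<i>) * u) - cos (\<i> * ((1 + \<i>) * u))"
    by (simp add: cosh_conv_cos)
  also have "\<dots> = 2 * sin (((1 + \<i>) * u + \<i> * ((1 + \<i>) * u)) / 2) *
                      sin ((\<i> * ((1 + \<i>) * u) - (1 + \<i>) * u) / 2)"
    by (rule cos_diff_cos)
  also have "((1 + \<i>) * u + \<i> * ((1 + \<i>) * u)) / 2 = \<i> * u"
    by (simp add: complex_eq_iff)
  also have "(\<i> * ((1 + \<i>) * u) - (1 + \<i>) * u) / 2 = -u"
    by (simp add: complex_eq_iff)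
  finally have "cos ((1 + \<i>) * u) - cosh ((1 + \<i>) * u) = 2 * sin (\<i> * u) * sin (-u)" .
  moreover have "sin (\<i> * u) = \<i> * sinh u"
    by (simp add: sinh_conv_sin)
  ultimately show ?thesis
    by (simp only: sin_minus) simp
qed

text \<open>At \<open>t (1 - \<i>)\<close> the substituted variable \<open>(1 + \<i>) u\<close> is
  \<open>2 t\<close>; at \<open>t (1 + \<i>)\<close> it is \<open>2 \<i> t\<close>, where
  \<open>cos\<close> and \<open>cosh\<close> are exchanged and their difference changes sign, hence
  \<open>(-1)^m\<close>. The common factor \<open>D\<close> is the integrand of the theorem at
  \<open>2 t\<close>.\<close>

lemma berndt_fun_rays:
  fixes t a :: real and m :: nat
  assumes "t > 0"
  defines "D \<equiv> complex_of_real ((2 * t) powr a / (cos (2 * t) - cosh (2 * t)) ^ m)"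
  shows "berndt_fun m a (of_real t * (1 - \<i>)) = (1 - \<i>) powr a * (-2 * \<i>) ^ m / 2 powr a * D"
    and "berndt_fun m a (of_real t * (1 + \<i>)) = (-1) ^ m * (1 + \<i>) powr a * (-2 * \<i>) ^ m / 2 powr a * D"
proof -
  define Q where "Q = cos (complex_of_real (2 * t)) - cosh (complex_of_real (2 * t))"
  have cosh_of_real: "cosh (complex_of_real x) = of_real (cosh x)" for x :: real
    by (simp add: cosh_field_def flip: exp_of_real)
  have D: "D = 2 powr a * of_real t powr a / Q ^ m"
    using assms by (simp add: D_def Q_def powr_mult powr_of_real cosh_of_real cos_of_real
                         flip: of_real_mult)
  have eq1: "(1 + \<i>) * (of_real t * (1 - \<i>)) = of_real (2 * t)"
    and eq2: "(1 + \<i>) * (of_real t * (1 + \<i>)) = \<i> * of_real (2 * t)"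
    by (simp_all add: algebra_simps)
  have 1: "Q = -2 * \<i> * (sinh (of_real t * (1 - \<i>)) * sin (of_real t * (1 - \<i>)))"
    using cos_minus_cosh_factor[of "of_real t * (1 - \<i>)"] unfolding eq1 by (simp add: Q_def)
  have 2: "-Q = -2 * \<i> * (sinh (of_real t * (1 + \<i>)) * sin (of_real t * (1 + \<i>)))"
    using cos_minus_cosh_factor[of "of_real t * (1 + \<i>)"] unfolding eq2
    by (simp add: Q_def cosh_conv_cos mult.assoc [symmetric])
  have pw: "(of_real t * z) powr of_real a = of_real t powr of_real a * z powr of_real a" for z :: complex
    using assms by (intro powr_times_real_left) auto
  define c where "c = -2 * \<i>"
  have c: "c \<noteq> 0"
    by (simp add: c_def)
  show "berndt_fun m a (of_real t * (1 - \<i>)) = (1 - \<i>) powr a * (-2 * \<i>) ^ m / 2 powr a * D"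
    unfolding D berndt_fun_def pw 1 c_def [symmetric] power_mult_distrib
    using c assms by (simp add: powr_of_real)
  define P where "P = sinh (of_real t * (1 + \<i>)) * sin (of_real t * (1 + \<i>))"
  have "Q = - (c * P)"
    using 2 by (simp add: c_def P_def)
  hence *: "Q ^ m = (-1) ^ m * (c ^ m * P ^ m)"
    by (simp add: power_minus [of "c * P"] power_mult_distrib)
  show "berndt_fun m a (of_real t * (1 + \<i>)) = (-1) ^ m * (1 + \<i>) powr a * (-2 * \<i>) ^ m / 2 powr a * D"
    unfolding D berndt_fun_def pw * c_def [symmetric] P_def [symmetric]
    using c assms by (simp add: powr_of_real)
qed

section \<open>The residue theorem on a triangle\<close>

lemma sin_eq_0_complex_halfplane:
  assumes "sin z = 0" "0 < Re z" "Re z < real (Suc N) * pi"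
  shows   "z \<in> (\<lambda>n. complex_of_real (real n * pi)) ` {1..N}"
proof -
  have "sin (Re z) ^ 2 + sinh (Im z) ^ 2 = 0"
    using norm_sin_sq[of z] assms(1) by simp
  hence "sin (Re z) = 0" and Im: "Im z = 0"
    by (simp_all add: sum_power2_eq_zero_iff)
  then obtain i :: int where i: "Re z = of_int i * pi"
    by (auto simp: sin_zero_iff_int2)
  have "0 < real_of_int i" "real_of_int i < real (Suc N)"
    using assms(2,3) unfolding i by (auto simp: zero_less_mult_iff mult_less_cancel_right)
  hence "i > 0" "i < int (Suc N)"
    by linarith+
  hence "Re z = real (nat i) * pi" "nat i \<in> {1..N}"
    using i by auto
  with Im show ?thesis
    by (intro image_eqI[of _ _ "nat i"]) (auto simp: complex_eq_iff)
qed

lemma holomorphic_berndt_fun: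
  "berndt_fun m a holomorphic_on {z. 0 < Re z \<and> sin z \<noteq> 0}"
proof -
  have "z \<notin> \<real>\<^sub>\<le>\<^sub>0" if "0 < Re z" for z :: complex
    using that by (auto simp: complex_nonpos_Reals_iff)
  thus ?thesis
    unfolding berndt_fun_def [abs_def] sinh_field_def [abs_def]
    using sinh_nonzero_Re unfolding sinh_field_def
    by (auto intro!: holomorphic_intros simp del: right_minus_eq) 
qed

text \<open>The triangle meets the real axis exactly in the segment from \<open>e\<close> to
  \<open>R\<close>. As \<open>0 < e < pi\<close> and \<open>R\<close> lies strictly between the
  poles \<open>N pi\<close> and \<open>(N + 1) pi\<close>, the poles enclosed are those with
  \<open>n = 1..N\<close>, and none is on the boundary.\<close>

lemma berndt_fun_triangle:
  fixes e R :: real and N :: nat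
  assumes e: "0 < e" "e < pi" and R: "real N * pi < R" "R < real (Suc N) * pi" "e < R"
  defines "p \<equiv> complex_of_real e"
  defines "q \<equiv> Complex R (-(R - e))" and "r \<equiv> Complex R (R - e)"
  shows "contour_integral (linepath p q) (berndt_fun m a) + contour_integral (linepath q r) (berndt_fun m a)
           + contour_integral (linepath r p) (berndt_fun m a) =
         2 * pi * \<i> * (\<Sum>n=1..N. residue (berndt_fun m a) (of_real (real n * pi)))"
    and "continuous_on (closed_segment p q) (berndt_fun m a)"
    and "continuous_on (closed_segment q r) (berndt_fun m a)"
    and "continuous_on (closed_segment r p) (berndt_fun m a)"
proof -
  \<comment> \<open>A convex domain that contains the triangle but omits 0 and
    \<open>(N + 1) pi\<close>, so that the zeros of \<open>sin\<close> in it are exactly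
    \<open>pts\<close>.\<close>
  define S where "S = {z. 0 < Re z} \<inter> {z. Re z < real (Suc N) * pi}"
  define pts where "pts = (\<lambda>n. complex_of_real (real n * pi)) ` {1..N}"
  define g where "g = linepath p q +++ linepath q r +++ linepath r p"
  have g: "valid_path g" "pathstart g = p" "pathfinish g = p"
    by (simp_all add: g_def valid_path_join)
  have S: "open S" "convex S"
    unfolding S_def by (auto intro!: open_Int convex_Int open_halfspace_Re_gt open_halfspace_Re_lt
                          convex_halfspace_Re_gt convex_halfspace_Re_lt)
  have conn: "connected S"
    using S(2) by (rule convex_connected)
  have pqr: "p \<in> S" "q \<in> S" "r \<in> S"
    using e R by (auto simp: S_def p_def q_def r_def)
  hence segS: "closed_segment p q \<subseteq> S" "closed_segment q r \<subseteq> S" "closed_segment r p \<subseteq> S"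
    using S(2) by (simp_all add: closed_segment_subset)
  have img: "path_image g = closed_segment p q \<union> closed_segment q r \<union> closed_segment r p"
    by (simp add: g_def path_image_join Un_assoc)
  have seg_pts: "z \<notin> pts" if z: "z \<in> path_image g" for z
  proof
    assume "z \<in> pts"
    then obtain n where n: "n \<in> {1..N}" "z = of_real (real n * pi)"
      by (auto simp: pts_def)
    have n1: "1 * pi \<le> real n * pi" "real n * pi \<le> real N * pi"
      using n by (intro mult_right_mono; simp)+
    consider "z \<in> closed_segment p q" | "z \<in> closed_segment q r" | "z \<in> closed_segment r p"
      using z img by auto
    thus False
    proof cases
      case 1
      then obtain t where "z = (1 - t) *\<^sub>R p + t *\<^sub>R q"
        by (auto simp: closed_segment_def)
      hence "real n * pi = (1 - t) * e + t * R" "0 = t * (R - e)"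
        by (auto simp: n(2) p_def q_def complex_eq_iff)
      hence "real n * pi = e"
        using R by auto
      thus False
        using n1 e by simp
    next
      case 2
      then obtain t where "z = (1 - t) *\<^sub>R q + t *\<^sub>R r"
        by (auto simp: closed_segment_def)
      hence "real n * pi = (1 - t) * R + t * R"
        by (simp add: n(2) q_def r_def complex_eq_iff)
      hence "real n * pi = R"
        by (simp add: algebra_simps)
      thus False
        using n1 R by simp
    next
      case 3
      then obtain t where "z = (1 - t) *\<^sub>R r + t *\<^sub>R p"
        by (auto simp: closed_segment_def)
      hence "real n * pi = (1 - t) * R + t * e" "0 = (1 - t) * (R - e)"
        by (auto simp: n(2) p_def r_def complex_eq_iff)
      hence "real n * pi = e"
        using R by auto
      thus False
        using n1 e by simp
    qed
  qed
  have sub: "S - pts \<subseteq> {z. 0 < Re z \<and> sin z \<noteq> 0}"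
    using sin_eq_0_complex_halfplane[of _ N] by (auto simp: S_def pts_def)
  have img_sub: "path_image g \<subseteq> S - pts"
    using seg_pts segS img by blast
  have holo: "berndt_fun m a holomorphic_on S - pts"
    using holomorphic_berndt_fun sub by (rule holomorphic_on_subset)
  have wn: "winding_number g z = 1" if "z \<in> pts" for z
  proof -
    from that obtain n where n: "n \<in> {1..N}" "z = of_real (real n * pi)"
      by (auto simp: pts_def)
    have n1: "1 * pi \<le> real n * pi" "real n * pi \<le> real N * pi"
      using n by (intro mult_right_mono; simp)+
    have lt: "e < real n * pi" "real n * pi < R"
      using n1 e R by linarith+
    \<comment> \<open>An open set inside the triangle; it places the pole in the interior of the
      convex hull, as the winding number of a triangle requires.\<close>
    define T where "T = {u. \<bar>Im u\<bar> < Re u - e} \<inter> {u. Re u < R}"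
    have "open {u::complex. \<bar>Im u\<bar> < Re u - e}"
      by (intro open_Collect_less continuous_intros)
    hence "open T"
      unfolding T_def by (intro open_Int open_halfspace_Re_lt)
    moreover have "T \<subseteq> convex hull {p, q, r}"
    proof
      fix u assume u: "u \<in> T"
      define v w where "v = (Re u - e) / (R - e)" and "w = Im u / (R - e)"
      have Re: "Re u = e + v * (R - e)" and Im: "Im u = w * (R - e)"
        using R by (simp_all add: v_def w_def)
      have "\<bar>w\<bar> = \<bar>Im u\<bar> / (R - e)"
        using R by (simp add: w_def)
      also have "\<dots> \<le> v"
        unfolding v_def using u R by (intro divide_right_mono) (auto simp: T_def)
      finally have "\<bar>w\<bar> \<le> v" .
      moreover have "v \<le> 1"
        using u R by (simp add: T_def v_def)
      \<comment> \<open>Barycentric coordinates: \<open>v\<close> is the relative distance from the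
        apex, and \<open>w\<close> the relative height, which divides \<open>v\<close> between the
        two far corners.\<close>
      moreover have "u = (1 - v) *\<^sub>R p + ((v - w) / 2) *\<^sub>R q + ((v + w) / 2) *\<^sub>R r"
        using Re Im by (simp add: complex_eq_iff p_def q_def r_def field_simps)
      ultimately show "u \<in> convex hull {p, q, r}"
        unfolding convex_hull_3
        by (intro CollectI exI[of _ "1 - v"] exI[of _ "(v - w) / 2"] exI[of _ "(v + w) / 2"])
           (auto simp: field_simps)
    qed
    moreover have "z \<in> T"
      unfolding T_def n(2) using lt by simp
    ultimately have "z \<in> interior (convex hull {p, q, r})"
      using interior_maximal by blast
    hence "winding_number g z = (if 0 < Im ((q - p) * cnj (q - z)) then 1 else -1)"
      unfolding g_def by (rule winding_number_triangle)
    \<comment> \<open>Positivity of this expression means that \<open>p\<close>, \<open>q\<close>,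
      \<open>r\<close> run counterclockwise around \<open>z\<close>.\<close>
    moreover have "Im ((q - p) * cnj (q - z)) = (R - e) * (real n * pi - e)"
      by (simp add: q_def p_def n(2) algebra_simps)
    moreover have "(R - e) * (real n * pi - e) > 0"
      using lt R by (intro mult_pos_pos) auto
    ultimately show ?thesis
      by simp
  qed
  have "contour_integral g (berndt_fun m a) =
          2 * pi * \<i> * (\<Sum>z\<in>pts. winding_number g z * residue (berndt_fun m a) z)"
  proof (rule Residue_theorem[OF S(1) conn _ holo])
    show "\<forall>z. z \<notin> S \<longrightarrow> winding_number g z = 0"
      using winding_number_zero_outside[OF valid_path_imp_path[OF g(1)] S(2)] g img_sub by auto
  qed (use g img_sub in \<open>auto simp: pts_def\<close>)
  also have "(\<Sum>z\<in>pts. winding_number g z * residue (berndt_fun m a) z) = (\<Sum>z\<in>pts. residue (berndt_fun m a) z)"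
    using wn by (intro sum.cong) auto
  also have "\<dots> = (\<Sum>n=1..N. residue (berndt_fun m a) (of_real (real n * pi)))"
    unfolding pts_def by (subst sum.reindex) (auto simp: inj_on_def)
  finally have "contour_integral g (berndt_fun m a) =
    2 * pi * \<i> * (\<Sum>n=1..N. residue (berndt_fun m a) (of_real (real n * pi)))" .
  moreover have cont: "continuous_on (S - pts) (berndt_fun m a)"
    using holo by (rule holomorphic_on_imp_continuous_on)
  show "continuous_on (closed_segment p q) (berndt_fun m a)"
       "continuous_on (closed_segment q r) (berndt_fun m a)"
       "continuous_on (closed_segment r p) (berndt_fun m a)"
    using img_sub img by (auto intro!: continuous_on_subset[OF cont])
  hence "berndt_fun m a contour_integrable_on linepath p q"
       "berndt_fun m a contour_integrable_on linepath q r"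
       "berndt_fun m a contour_integrable_on linepath r p"
    by (simp_all add: contour_integrable_continuous_linepath)
  hence "contour_integral g (berndt_fun m a) = contour_integral (linepath p q) (berndt_fun m a) +
           contour_integral (linepath q r) (berndt_fun m a) + contour_integral (linepath r p) (berndt_fun m a)"
    unfolding g_def by (subst contour_integral_join | simp)+
  ultimately show "contour_integral (linepath p q) (berndt_fun m a) + contour_integral (linepath q r) (berndt_fun m a)
           + contour_integral (linepath r p) (berndt_fun m a) =
         2 * pi * \<i> * (\<Sum>n=1..N. residue (berndt_fun m a) (of_real (real n * pi)))"
    by simp
qed

section \<open>Passage to the limit\<close>

text \<open>With the parameter in \<open>[0, r]\<close> instead of \<open>[0, 1]\<close>, the
  integrands belonging to different triangles can be compared pointwise in \<open>t\<close>, as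
  dominated convergence requires.\<close>

lemma contour_integral_linepath_ray:
  fixes f :: "complex \<Rightarrow> complex"
  assumes r: "r > 0" and cont: "continuous_on (closed_segment z (z + of_real r * w)) f"
  shows "contour_integral (linepath z (z + of_real r * w)) f = (LBINT t:{0..r}. f (z + of_real t * w) * w)"
proof -
  define h where "h = (\<lambda>t. f (z + of_real t * w) * w)"
  have "z + of_real t * w \<in> closed_segment z (z + of_real r * w)" if "t \<in> {0..r}" for t
    using that r unfolding closed_segment_def
    by (intro CollectI exI[of _ "t / r"]) (auto simp: scaleR_conv_of_real field_simps)
  hence "continuous_on {0..r} h"
    unfolding h_def by (intro continuous_intros continuous_on_compose2[OF cont]) auto
  hence h: "set_integrable lborel {0..r} h"
    by (rule borel_integrable_atLeastAtMost')
  have "(h has_integral (LBINT t:{0..r}. h t)) {0..r}"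
    using set_borel_integral_eq_integral[OF h] by (simp add: integrable_integral)
  hence "((\<lambda>x. h (r * x)) has_integral (1 / \<bar>r\<bar>) *\<^sub>R (LBINT t:{0..r}. h t)) ((\<lambda>x. x / r) ` {0..r})"
    using r by (intro has_integral_stretch_real) auto
  also have "(\<lambda>x. x / r) ` {0..r} = {0..1}"
    using r by (simp add: image_divide_atLeastAtMost)
  finally have "((\<lambda>x. h (r * x) * of_real r) has_integral
      ((1 / \<bar>r\<bar>) *\<^sub>R (LBINT t:{0..r}. h t)) * of_real r) {0..1}"
    by (rule has_integral_mult_left)
  also have "((1 / \<bar>r\<bar>) *\<^sub>R (LBINT t:{0..r}. h t)) * of_real r = (LBINT t:{0..r}. h t)"
    using r by (simp add: scaleR_conv_of_real)
  also have "(\<lambda>x. h (r * x) * of_real r) = 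
      (\<lambda>x. f (linepath z (z + of_real r * w) x) * (z + of_real r * w - z))"
    by (simp add: h_def linepath_def fun_eq_iff scaleR_conv_of_real algebra_simps)
  finally have "(f has_contour_integral (LBINT t:{0..r}. h t)) (linepath z (z + of_real r * w))"
    by (simp add: has_contour_integral_linepath)
  thus ?thesis
    by (simp add: h_def contour_integral_unique)
qed

text \<open>Away from its starting point the ray has nonzero imaginary part, so \<open>sin\<close>
  does not vanish; at the starting point \<open>0 < e < pi\<close> ensures this. The last hypothesis
  admits closed rays with \<open>e > 0\<close> as well as the open ray issuing from 0.\<close>

lemma continuous_on_berndt_fun_ray:
  fixes e s :: real
  assumes "0 \<le> e" "e < pi" "\<bar>s\<bar> = 1" "A \<subseteq> {0..}" "0 < e \<or> 0 \<notin> A"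
  shows "continuous_on A (\<lambda>t. berndt_fun m a (of_real e + of_real t * Complex 1 s))"
proof (rule continuous_on_compose2[OF holomorphic_on_imp_continuous_on[OF holomorphic_berndt_fun]])
  show "(\<lambda>t. of_real e + of_real t * Complex 1 s) ` A \<subseteq> {z. 0 < Re z \<and> sin z \<noteq> 0}"
  proof (rule image_subsetI)
    fix t assume t: "t \<in> A"
    define z where "z = of_real e + of_real t * Complex 1 s"
    have t0: "t \<ge> 0" "0 < e + t"
      using t assms by (cases "t = 0"; force)+
    have "sin z \<noteq> 0"
    proof (cases "t = 0")
      case True
      have "sin e > 0"
        using assms t True by (intro sin_gt_zero) auto
      thus ?thesis
        using True by (simp add: z_def sin_of_real)
    next
      case False
      hence "0 < sinh \<bar>Im z\<bar>"
        using t0 assms by (simp add: z_def abs_mult)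
      also have "\<dots> \<le> norm (sin z)"
        by (rule norm_sin_ge_sinh)
      finally show ?thesis
        by auto
    qed
    moreover have "0 < Re z"
      using t0 by (simp add: z_def)
    ultimately show "of_real e + of_real t * Complex 1 s \<in> {z. 0 < Re z \<and> sin z \<noteq> 0}"
      by (simp add: z_def)
  qed
qed (auto intro!: continuous_intros)

text \<open>Dominated convergence with majorant \<open>K * exp (-t/2) * norm w\<close> treats the
  moving apex and the growing length at the same time, and yields integrability on the limiting ray
  as well.\<close>

lemma berndt_fun_ray_integral:
  fixes a s :: real and e r :: "nat \<Rightarrow> real"
  assumes m: "m \<ge> 1" and a: "a \<ge> 2 * real m" and s: "\<bar>s\<bar> = 1"
    and e: "\<And>N. 0 < e N" "\<And>N. e N \<le> 1/2" "e \<longlonglongrightarrow> 0" and r: "filterlim r at_top sequentially"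
  defines "w \<equiv> Complex 1 s"
  shows "set_integrable lborel {0<..} (\<lambda>t. berndt_fun m a (of_real t * w) * w)"
    and "(\<lambda>N. LBINT t:{0..r N}. berndt_fun m a (of_real (e N) + of_real t * w) * w) \<longlonglongrightarrow>
           (LBINT t:{0<..}. berndt_fun m a (of_real t * w) * w)"
proof -
  define K where "K = 8 ^ m * 2 powr a * 3 * (2 * a) powr a"
  have K: "K \<ge> 0"
    by (simp add: K_def)
  define B where "B = (\<lambda>t. indicator {0..} t *\<^sub>R (exp (-(1/2) * t) * (K * norm w)))"
  have "set_integrable lebesgue {0::real..} (\<lambda>t. exp (-(1/2) * t))"
    using has_integral_exp_minus_to_infinity[of "1/2" 0]
    by (intro nonnegative_absolutely_integrable_1) (auto simp: integrable_on_def)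
  hence "set_integrable lborel {0::real..} (\<lambda>t. exp (-(1/2) * t))"
    unfolding set_integrable_def by (subst (asm) integrable_completion) auto
  hence "set_integrable lborel {0::real..} (\<lambda>t. exp (-(1/2) * t) * (K * norm w))"
    by (rule set_integrable_mult_left[rotated])
  hence B: "integrable lborel B"
    unfolding set_integrable_def B_def by simp
  have pi: "e N < pi" for N
    using e(2)[of N] pi_gt3 by linarith
  define f where "f = (\<lambda>t. indicator {0<..} t *\<^sub>R (berndt_fun m a (of_real t * w) * w))"
  define F where "F = (\<lambda>N t. indicator {0..r N} t *\<^sub>R (berndt_fun m a (of_real (e N) + of_real t * w) * w))"
  have cont0: "continuous_on {0<..} (\<lambda>t. berndt_fun m a (of_real t * w))"
    unfolding w_def using continuous_on_berndt_fun_ray[of 0 s "{0<..}" m a, OF _ _ s] pi_gt_zero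
    by (simp add: subset_iff)
  have meas: "f \<in> borel_measurable lborel"
    unfolding f_def measurable_lborel1 measurable_lborel2
    by (intro borel_measurable_continuous_on_indicator continuous_intros cont0) auto
  have measF: "F N \<in> borel_measurable lborel" for N
    unfolding F_def measurable_lborel1 measurable_lborel2 w_def
    by (intro borel_measurable_continuous_on_indicator continuous_intros continuous_on_berndt_fun_ray)
       (use e pi s less_imp_le[OF e(1)] in auto)
  \<comment> \<open>The point \<open>t = 0\<close> is set aside as a null set: there the indicator
    of the shifted ray is 1 for large \<open>N\<close>, while that of the limit is 0.\<close>
  have lim: "AE t in lborel. (\<lambda>N. F N t) \<longlonglongrightarrow> f t"
    using AE_lborel_singleton[of 0]
  proof eventually_elim
    case (elim t)
    show ?case
    proof (cases "t > 0")
      case True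
      have "isCont (berndt_fun m a) (of_real t * w)"
      proof -
        have "{z. 0 < Re z \<and> sin z \<noteq> 0} = {z. 0 < Re z} \<inter> {z::complex. sin z \<noteq> 0}"
          by auto
        moreover have "open {z::complex. sin z \<noteq> 0}"
          by (intro open_Collect_neq continuous_intros)
        ultimately have "open {z. 0 < Re z \<and> sin z \<noteq> 0}"
          by (simp add: open_Int open_halfspace_Re_gt)
        moreover have "sin (of_real t * w) \<noteq> 0"
        proof -
          have "0 < sinh \<bar>Im (of_real t * w)\<bar>"
            using True s by (simp add: w_def abs_mult)
          also have "\<dots> \<le> norm (sin (of_real t * w))"
            by (rule norm_sin_ge_sinh)
          finally show ?thesis by auto
        qed
        ultimately show ?thesis
          using holomorphic_on_imp_continuous_on[OF holomorphic_berndt_fun] True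
          by (subst (asm) continuous_on_eq_continuous_at) (auto simp: w_def)
      qed
      moreover have "(\<lambda>N. of_real (e N) + of_real t * w) \<longlonglongrightarrow> of_real 0 + of_real t * w"
        by (intro tendsto_intros e)
      hence "(\<lambda>N. of_real (e N) + of_real t * w) \<longlonglongrightarrow> of_real t * w"
        by simp
      ultimately have "(\<lambda>N. berndt_fun m a (of_real (e N) + of_real t * w)) \<longlonglongrightarrow> berndt_fun m a (of_real t * w)"
        by (rule isCont_tendsto_compose)
      hence "(\<lambda>N. berndt_fun m a (of_real (e N) + of_real t * w) * w) \<longlonglongrightarrow> f t"
        using True by (auto simp: f_def intro!: tendsto_intros)
      moreover have "eventually (\<lambda>N. r N \<ge> t) sequentially"
        using r by (simp add: filterlim_at_top)
      hence "eventually (\<lambda>N. berndt_fun m a (of_real (e N) + of_real t * w) * w = F N t) sequentially"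
        by eventually_elim (use True in \<open>auto simp: F_def\<close>)
      ultimately show ?thesis
        by (rule Lim_transform_eventually)
    next
      case False
      with elim show ?thesis
        by (simp add: F_def f_def)
    qed
  qed
  have bound: "norm (F N t) \<le> B t" for N t
  proof (cases "t \<in> {0..r N}")
    case True
    define u where "u = of_real (e N) + of_real t * w"
    have u: "Re u = e N + t" "\<bar>Im u\<bar> = t"
      using s True by (auto simp: u_def w_def abs_mult)
    \<comment> \<open>On the shifted ray \<open>Re u - \<bar>Im u\<bar> = e N\<close>, so
      \<open>e N \<le> 1/2\<close> is exactly what the sector estimate asks for.\<close>
    have "norm (berndt_fun m a u) \<le> K * exp (- Re u / 2)"
      unfolding K_def using u e(1)[of N] e(2)[of N] True
      by (intro norm_berndt_fun_le m a) auto
    also have "\<dots> \<le> K * exp (-(1/2) * t)"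
      using e(1)[of N] K by (intro mult_left_mono) (auto simp: u)
    finally have "norm (berndt_fun m a u) * norm w \<le> K * exp (-(1/2) * t) * norm w"
      by (intro mult_right_mono) auto
    thus ?thesis
      using True by (simp add: F_def B_def u_def norm_mult mult_ac)
  next
    case False
    thus ?thesis
      using K by (simp add: F_def B_def)
  qed
  show "set_integrable lborel {0<..} (\<lambda>t. berndt_fun m a (of_real t * w) * w)"
    using integrable_dominated_convergence[OF meas measF B lim AE_I2[OF bound]]
    unfolding set_integrable_def f_def .
  show "(\<lambda>N. LBINT t:{0..r N}. berndt_fun m a (of_real (e N) + of_real t * w) * w) \<longlonglongrightarrow>
           (LBINT t:{0<..}. berndt_fun m a (of_real t * w) * w)"
    using integral_dominated_convergence[OF meas measF B lim AE_I2[OF bound]]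
    unfolding set_lebesgue_integral_def f_def F_def .
qed

text \<open>Half-way between two poles \<open>sin R\<close> has square 1, so
  \<open>norm (sin u) \<ge> 1\<close> on the whole side. Since also \<open>sinh R \<ge> 1\<close>, a
  single factor \<open>sinh R\<close> bounds the \<open>m\<close>-th power from below.\<close>

lemma norm_berndt_fun_vertical_le:
  fixes a y :: real and N :: nat
  assumes m: "m \<ge> 1" and a: "a \<ge> 0"
  defines "R \<equiv> (real N + 1/2) * pi"
  assumes y: "\<bar>y\<bar> \<le> R"
  shows "norm (berndt_fun m a (Complex R y)) \<le> (2 * R) powr a / sinh R"
proof -
  define u where "u = Complex R y"
  have "1/2 * pi \<le> R"
    unfolding R_def by (intro mult_right_mono) auto
  hence "1 \<le> R"
    using pi_gt3 by linarith
  have "sin R ^ 2 = 1"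
  proof -
    have "sin R = cos (real N * pi)"
      by (simp add: R_def sin_add ring_distribs)
    thus ?thesis
      by (simp add: power2_eq_square flip: power_mult_distrib)
  qed
  hence "1 ^ 2 \<le> norm (sin u) ^ 2"
    unfolding norm_sin_sq by (simp add: u_def)
  hence 1: "1 \<le> norm (sin u)"
    by (rule power2_le_imp_le) auto
  have 2: "sinh R \<le> norm (sinh u)"
    using norm_sinh_ge[of u] by (simp add: u_def)
  have sinh: "1 \<le> sinh R"
    using sinh_real_ge[of R] \<open>1 \<le> R\<close> by linarith
  have "sinh R \<le> (sinh R * 1) ^ m"
    using power_increasing[of 1 m "sinh R"] sinh m by simp
  also have "\<dots> \<le> (norm (sinh u) * norm (sin u)) ^ m"
    using 1 2 sinh by (intro power_mono mult_mono) (use \<open>1 \<le> R\<close> in auto)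
  finally have den: "sinh R \<le> (norm (sinh u) * norm (sin u)) ^ m" .
  have "norm u \<le> 2 * R"
    using cmod_le[of u] y \<open>1 \<le> R\<close> by (simp add: u_def)
  hence "norm u powr a \<le> (2 * R) powr a"
    using a by (intro powr_mono2) auto
  hence "norm u powr a / (norm (sinh u) * norm (sin u)) ^ m \<le> (2 * R) powr a / sinh R"
    using den sinh \<open>1 \<le> R\<close> by (intro frac_le) auto
  thus ?thesis
    by (simp add: berndt_fun_def norm_divide norm_mult norm_power norm_powr_real_powr' u_def)
qed

lemma residue_sum_berndt_fun:
  fixes a :: real
  assumes m: "m \<ge> 1" and a: "a \<ge> 2 * real m"
  shows "(\<lambda>N. 2 * pi * \<i> * (\<Sum>n=1..N. residue (berndt_fun m a) (of_real (real n * pi)))) \<longlonglongrightarrow>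
           (LBINT t:{0<..}. berndt_fun m a (of_real t * (1 - \<i>)) * (1 - \<i>)) -
           (LBINT t:{0<..}. berndt_fun m a (of_real t * (1 + \<i>)) * (1 + \<i>))"
proof -
  \<comment> \<open>The apex \<open>1 / (N + 2)\<close> tends to 0 and satisfies the bound
    \<open>1/2\<close> already for \<open>N = 0\<close>.\<close>
  define R e where "R = (\<lambda>N. (real N + 1/2) * pi)" and "e = (\<lambda>N. 1 / (real N + 2))"
  define p q r where "p = (\<lambda>N. complex_of_real (e N))" and "q = (\<lambda>N. Complex (R N) (-(R N - e N)))"
    and "r = (\<lambda>N. Complex (R N) (R N - e N))"
  have e: "0 < e N" "e N \<le> 1/2" "e \<longlonglongrightarrow> 0" for N
  proof -
    show "e \<longlonglongrightarrow> 0"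
      unfolding e_def by real_asymp
  qed (auto simp: e_def)
  have epi: "e N < pi" for N
    using e(2)[of N] pi_gt3 by linarith
  have R: "real N * pi < R N" "R N < real (Suc N) * pi" "e N < R N" "1/2 < R N" for N
  proof -
    show "real N * pi < R N" "R N < real (Suc N) * pi"
      by (simp_all add: R_def)
    have "1/2 * pi \<le> R N"
      unfolding R_def by (intro mult_right_mono) auto
    thus "1/2 < R N"
      using pi_gt3 by linarith
    with e(2)[of N] show "e N < R N"
      by linarith
  qed
  have lim_r: "filterlim (\<lambda>N. R N - e N) at_top sequentially"
    unfolding R_def e_def by real_asymp
  have pqr: "p N = complex_of_real (e N)" "q N = Complex (R N) (-(R N - e N))"
    "r N = Complex (R N) (R N - e N)" for N
    by (simp_all add: p_def q_def r_def)
  note tri = berndt_fun_triangle[OF e(1) epi R(1-3), folded pqr]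
  have w: "1 - \<i> = Complex 1 (-1)" "1 + \<i> = Complex 1 1"
    by (simp_all add: complex_eq_iff)
  have qp: "q N = p N + of_real (R N - e N) * (1 - \<i>)" and rp: "r N = p N + of_real (R N - e N) * (1 + \<i>)" for N
    by (simp_all add: p_def q_def r_def complex_eq_iff)
  have lower: "contour_integral (linepath (p N) (q N)) (berndt_fun m a) =
      (LBINT t:{0..R N - e N}. berndt_fun m a (p N + of_real t * (1 - \<i>)) * (1 - \<i>))" for N
    using contour_integral_linepath_ray[of "R N - e N" "p N" "1 - \<i>" "berndt_fun m a"] R(3)[of N] tri(2)[of N]
    unfolding qp [symmetric] by simp
  have "continuous_on (closed_segment (p N) (r N)) (berndt_fun m a)" for N
    using tri(4)[of N] by (simp add: closed_segment_commute)
  hence upper: "contour_integral (linepath (r N) (p N)) (berndt_fun m a) =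
      -(LBINT t:{0..R N - e N}. berndt_fun m a (p N + of_real t * (1 + \<i>)) * (1 + \<i>))" for N
    using contour_integral_linepath_ray[of "R N - e N" "p N" "1 + \<i>" "berndt_fun m a"] R(3)[of N]
      contour_integral_reverse_linepath[OF tri(4), of N]
    unfolding rp [symmetric] by simp
  have vertical: "(\<lambda>N. contour_integral (linepath (q N) (r N)) (berndt_fun m a)) \<longlonglongrightarrow> 0"
  proof (rule Lim_null_comparison[OF always_eventually], rule allI)
    fix N
    have "norm (contour_integral (linepath (q N) (r N)) (berndt_fun m a)) \<le>
            (2 * R N) powr a / sinh (R N) * norm (r N - q N)"
    proof (rule has_contour_integral_bound_linepath)
      show "(berndt_fun m a has_contour_integral
              contour_integral (linepath (q N) (r N)) (berndt_fun m a)) (linepath (q N) (r N))"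
        by (intro has_contour_integral_integral contour_integrable_continuous_linepath tri(3))
      show "0 \<le> (2 * R N) powr a / sinh (R N)"
        using R(4)[of N] by simp
      fix u assume "u \<in> closed_segment (q N) (r N)"
      then obtain t where t: "0 \<le> t" "t \<le> 1" "u = (1 - t) *\<^sub>R q N + t *\<^sub>R r N"
        by (auto simp: closed_segment_def)
      have u: "u = Complex (R N) ((2 * t - 1) * (R N - e N))"
        by (simp add: t(3) q_def r_def complex_eq_iff algebra_simps)
      have "\<bar>(2 * t - 1) * (R N - e N)\<bar> \<le> 1 * R N"
        unfolding abs_mult using t R(3)[of N] e(1)[of N] by (intro mult_mono) auto
      thus "norm (berndt_fun m a u) \<le> (2 * R N) powr a / sinh (R N)"
        unfolding u R_def using m a by (intro norm_berndt_fun_vertical_le) auto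
    qed
    also have "\<dots> \<le> (2 * R N) powr a / sinh (R N) * (2 * R N)"
    proof -
      have "r N - q N = \<i> * of_real (2 * (R N - e N))"
        by (simp add: q_def r_def complex_eq_iff)
      hence "norm (r N - q N) \<le> 2 * R N"
        using R(3)[of N] e(1)[of N] by (simp only: norm_mult norm_of_real) simp
      thus ?thesis
        using R(4)[of N] by (intro mult_left_mono) auto
    qed
    finally show "norm (contour_integral (linepath (q N) (r N)) (berndt_fun m a)) \<le>
            (2 * R N) powr a / sinh (R N) * (2 * R N)" .
  next
    show "(\<lambda>N. (2 * R N) powr a / sinh (R N) * (2 * R N)) \<longlonglongrightarrow> 0"
      unfolding R_def by real_asymp
  qed
  \<comment> \<open>The triangle runs outward along the lower ray and back along the upper one, so
    the upper ray integral enters with a minus sign.\<close>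
  have "(\<lambda>N. contour_integral (linepath (p N) (q N)) (berndt_fun m a)
           + contour_integral (linepath (q N) (r N)) (berndt_fun m a)
           + contour_integral (linepath (r N) (p N)) (berndt_fun m a)) \<longlonglongrightarrow>
           (LBINT t:{0<..}. berndt_fun m a (of_real t * (1 - \<i>)) * (1 - \<i>)) + 0 +
           (-(LBINT t:{0<..}. berndt_fun m a (of_real t * (1 + \<i>)) * (1 + \<i>)))"
    unfolding lower upper unfolding p_def w
    by (intro tendsto_intros vertical berndt_fun_ray_integral(2)[OF m a _ e lim_r]) auto
  thus ?thesis
    unfolding tri(1) by simp
qed

section \<open>Evaluation of the residue sum and of the ray integrals\<close>

lemma residue_berndt_fun:
  fixes a :: real
  assumes m: "m \<ge> 1"
  shows "residue (berndt_fun m a) (of_real (real (Suc n) * pi)) =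
    (\<Sum>l=0..(m - 1) div 2. \<Sum>j=0..m - 1 - 2 * l.
       of_real ((-2) ^ l * gamma_coeff l m / fact (m - 1 - 2 * l - j) * (a gchoose j) * pi powr (a - real j)) *
       (deriv ^^ (m - 1 - 2 * l - j)) (csinh_term m (a + 1 + 2 * real l - real m) n) (of_real pi))"
proof -
  define x where "x = real (Suc n) * pi"
  define D where "D = (\<lambda>k. (deriv ^^ k) (\<lambda>u. 1 / sinh u ^ m) (complex_of_real x))"
  define G where "G = (\<lambda>i. (-1) ^ (m * Suc n) * (\<Sum>j\<le>m-1-i. of_real ((a gchoose j) * x powr (a - real j)) *
                (D (m-1-i-j) / fact (m-1-i-j))))"
  have "residue (berndt_fun m a) (of_real x) =
          (-1) ^ (m * Suc n) * (\<Sum>i\<le>m-1. fps_nth (fps_X_over_sin ^ m) i *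
             (\<Sum>j\<le>m-1-i. of_real ((a gchoose j) * x powr (a - real j)) *
                (D (m-1-i-j) / fact (m-1-i-j))))"
    unfolding berndt_fun_def [abs_def] x_def D_def by (rule residue_powr_sinh_sin) (use m in auto)
  also have "\<dots> = (\<Sum>i\<le>m-1. fps_nth (fps_X_over_sin ^ m) i * G i)"
    by (simp add: G_def sum_distrib_left mult_ac)
  \<comment> \<open>Only even indices \<open>i = 2 l\<close> survive, which yields the range
    \<open>l \<le> (m - 1) div 2\<close>.\<close>
  also have "\<dots> = (\<Sum>i\<in>(\<lambda>l. 2 * l) ` {0..(m - 1) div 2}. fps_nth (fps_X_over_sin ^ m) i * G i)"
  proof (intro sum.mono_neutral_right ballI)
    fix i assume i: "i \<in> {..m-1} - (\<lambda>l. 2 * l) ` {0..(m - 1) div 2}"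
    have "odd i"
    proof
      assume "even i"
      then obtain l where "i = 2 * l" by blast
      with i show False by auto
    qed
    thus "fps_nth (fps_X_over_sin ^ m) i * G i = 0"
      by (simp add: fps_X_over_sin_power_nth)
  qed auto
  also have "\<dots> = (\<Sum>l=0..(m - 1) div 2. of_real ((-2) ^ l * gamma_coeff l m) * G (2 * l))"
    by (subst sum.reindex) (auto simp: inj_on_def fps_X_over_sin_power_nth)
  also have "\<dots> = (\<Sum>l=0..(m - 1) div 2. \<Sum>j=0..m - 1 - 2 * l.
       of_real ((-2) ^ l * gamma_coeff l m / fact (m - 1 - 2 * l - j) * (a gchoose j) * pi powr (a - real j)) *
       (deriv ^^ (m - 1 - 2 * l - j)) (csinh_term m (a + 1 + 2 * real l - real m) n) (of_real pi))"
  proof (intro sum.cong refl)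
    fix l assume l: "l \<in> {0..(m - 1) div 2}"
    have "of_real ((-2) ^ l * gamma_coeff l m) * G (2 * l) = 
          (\<Sum>j=0..m - 1 - 2 * l. of_real ((-2) ^ l * gamma_coeff l m) * (-1) ^ (m * Suc n) *
             (of_real ((a gchoose j) * x powr (a - real j)) *
                (D (m - 1 - 2 * l - j) / fact (m - 1 - 2 * l - j))))"
      by (simp add: G_def sum_distrib_left mult_ac atLeast0AtMost)
    also have "\<dots> = (\<Sum>j=0..m - 1 - 2 * l.
       of_real ((-2) ^ l * gamma_coeff l m / fact (m - 1 - 2 * l - j) * (a gchoose j) * pi powr (a - real j)) *
       (deriv ^^ (m - 1 - 2 * l - j)) (csinh_term m (a + 1 + 2 * real l - real m) n) (of_real pi))"
    proof (intro sum.cong refl)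
      fix j assume j: "j \<in> {0..m - 1 - 2 * l}"
      define k where "k = m - 1 - 2 * l - j"
      \<comment> \<open>With this \<open>k\<close>, the exponent \<open>a + 1 + 2 l - m\<close> of
        the term becomes \<open>a - j\<close> after \<open>k\<close> derivatives, matching the power
        of \<open>n\<close> in \<open>x powr (a - j)\<close>.\<close>
      have "real k = real m - 1 - 2 * real l - real j"
        using j l m unfolding k_def by (auto simp: of_nat_diff)
      hence "(deriv ^^ k) (csinh_term m (a + 1 + 2 * real l - real m) n) (of_real pi) =
               (-1) ^ (m * Suc n) * of_real (real (Suc n) powr (a - real j)) * D k"
        by (subst higher_deriv_csinh_term) (auto simp: D_def x_def simp del: of_nat_Suc)
      moreover have "x powr (a - real j) = pi powr (a - real j) * real (Suc n) powr (a - real j)"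
        by (simp add: x_def powr_mult del: of_nat_Suc)
      ultimately show "of_real ((-2) ^ l * gamma_coeff l m) * (-1) ^ (m * Suc n) *
             (of_real ((a gchoose j) * x powr (a - real j)) *
                (D (m - 1 - 2 * l - j) / fact (m - 1 - 2 * l - j))) =
          of_real ((-2) ^ l * gamma_coeff l m / fact (m - 1 - 2 * l - j) * (a gchoose j) * pi powr (a - real j)) *
       (deriv ^^ (m - 1 - 2 * l - j)) (csinh_term m (a + 1 + 2 * real l - real m) n) (of_real pi)"
        unfolding k_def [symmetric] by (simp del: of_nat_Suc mult_Suc_right)
    qed
    finally show "of_real ((-2) ^ l * gamma_coeff l m) * G (2 * l) = (\<Sum>j=0..m - 1 - 2 * l.
       of_real ((-2) ^ l * gamma_coeff l m / fact (m - 1 - 2 * l - j) * (a gchoose j) * pi powr (a - real j)) *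
       (deriv ^^ (m - 1 - 2 * l - j)) (csinh_term m (a + 1 + 2 * real l - real m) n) (of_real pi))" .
  qed
  finally show ?thesis
    by (simp only: x_def)
qed

lemma residue_berndt_fun_sums:
  fixes a :: real
  assumes m: "m \<ge> 1"
  shows "(\<lambda>n. residue (berndt_fun m a) (of_real (real (Suc n) * pi))) sums
    of_real (\<Sum>l=0..(m - 1) div 2. \<Sum>j=0..m - 1 - 2 * l.
       (-2) ^ l * gamma_coeff l m / fact (m - 1 - 2 * l - j) * (a gchoose j) * pi powr (a - real j) *
       (deriv ^^ (m - 1 - 2 * l - j)) (sinh_series m (a + 1 + 2 * real l - real m)) pi)"
  unfolding residue_berndt_fun[OF m] of_real_sum
proof (intro sums_sum)
  fix l j
  define c where "c = (-2) ^ l * gamma_coeff l m / fact (m - 1 - 2 * l - j) * (a gchoose j) * pi powr (a - real j)"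
  define k where "k = m - 1 - 2 * l - j"
  define s where "s = a + 1 + 2 * real l - real m"
  have "(\<lambda>n. of_real c * (deriv ^^ k) (csinh_term m s n) (of_real pi)) sums
          (of_real c * of_real ((deriv ^^ k) (sinh_series m s) pi))"
    unfolding higher_deriv_sinh_series(1)[OF m pi_gt_zero]
    by (intro sums_mult higher_deriv_csinh_series m) auto
  thus "(\<lambda>n. of_real ((-2) ^ l * gamma_coeff l m / fact (m - 1 - 2 * l - j) * (a gchoose j) * pi powr (a - real j)) *
          (deriv ^^ (m - 1 - 2 * l - j)) (csinh_term m (a + 1 + 2 * real l - real m) n) (of_real pi)) sums
        of_real ((-2) ^ l * gamma_coeff l m / fact (m - 1 - 2 * l - j) * (a gchoose j) * pi powr (a - real j) *
          (deriv ^^ (m - 1 - 2 * l - j)) (sinh_series m (a + 1 + 2 * real l - real m)) pi)"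
    unfolding c_def k_def s_def by simp
qed

section \<open>The constant in front of the integral, and the substitution on the rays\<close>

lemma berndt_constant:
  fixes a :: real
  shows "2 powi (int m - 2) * (1 - (-1) ^ m * \<i> powr complex_of_real (a + 1))
           / (\<i> ^ m * (1 + \<i>) powr complex_of_real (a - 1)) =
         \<i> / 4 * ((-2 * \<i>) ^ m / 2 powr complex_of_real a) *
           ((1 - \<i>) powr a * (1 - \<i>) - (-1) ^ m * (1 + \<i>) powr a * (1 + \<i>))"
proof -
  define W where "W = (1 - \<i>) powr complex_of_real a"
  define C where "C = (1 + \<i>) powr complex_of_real a"
  define E where "E = \<i> powr complex_of_real a"
  define P where "P = 2 powr complex_of_real a"
  have "1 + \<i> \<noteq> 0" "1 - \<i> \<noteq> 0"
    by (simp_all add: complex_eq_iff)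
  hence nz: "1 + \<i> \<noteq> 0" "1 - \<i> \<noteq> 0" "W \<noteq> 0" "C \<noteq> 0" "E \<noteq> 0" "P \<noteq> 0"
    by (simp_all add: W_def C_def E_def P_def)
  have eq: "1 + \<i> = \<i> * (1 - \<i>)" "1 - \<i> = of_real 2 * inverse (1 + \<i>)"
    by (auto simp: complex_eq_iff Re_divide Im_divide)
  \<comment> \<open>The argument of \<open>1 - \<i>\<close> is \<open>-\<pi>/4\<close>; adding
    \<open>\<pi>/2\<close> stays in the principal range, so no multiple of
    \<open>2 \<pi> \<i>\<close> appears.\<close>
  have "Ln (1 + \<i>) = Ln (1 - \<i>) + \<i> * of_real pi / 2"
    by (subst eq(1), subst Ln_times_ii) (use nz in simp_all)
  hence C: "C = E * W"
    using nz by (simp add: C_def E_def W_def powr_def algebra_simps flip: exp_add)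
  have "W = (of_real 2 * inverse (1 + \<i>)) powr complex_of_real a"
    unfolding W_def by (simp only: eq(2))
  also have "\<dots> = P * (inverse (1 + \<i>)) powr complex_of_real a"
    unfolding P_def by (subst powr_times_real_left) auto
  also have "(inverse (1 + \<i>)) powr complex_of_real a = inverse C"
    using nz by (simp add: C_def powr_def Ln_inverse complex_nonpos_Reals_iff flip: exp_minus)
  \<comment> \<open>The principal arguments of \<open>1 + \<i>\<close> and \<open>1 - \<i>\<close>
    are opposite, so \<open>(1 + \<i>) (1 - \<i>) = 2\<close> may be raised to the power
    \<open>a\<close> factor by factor.\<close>
  finally have P: "P = C * W"
    using nz by (simp add: field_simps)
  have i1: "\<i> powr complex_of_real (a + 1) = E * \<i>"
    by (simp add: E_def powr_add)
  have c1: "(1 + \<i>) powr complex_of_real (a - 1) = C / (1 + \<i>)"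
    using nz by (simp add: C_def powr_diff)
  have pm: "2 powi (int m - 2) = (2 :: complex) ^ m / 4"
    by (simp add: power_int_diff)
  have "(-2 * \<i>) * \<i> = 2"
    by (simp add: complex_eq_iff)
  hence "((-2 * \<i>) * \<i>) ^ m = 2 ^ m"
    by (simp only:)
  hence im: "(-2 * \<i>) ^ m = 2 ^ m / \<i> ^ m"
    unfolding power_mult_distrib by (simp add: field_simps)
  have "\<i> * (W * (1 - \<i>) - (-1) ^ m * C * (1 + \<i>)) = W * (1 + \<i>) * (1 - (-1) ^ m * (E * \<i>))"
    unfolding C by (simp add: algebra_simps)
  hence "2 ^ m / 4 / \<i> ^ m / P * (\<i> * (W * (1 - \<i>) - (-1) ^ m * C * (1 + \<i>))) =
         2 ^ m / 4 / \<i> ^ m / P * (W * (1 + \<i>) * (1 - (-1) ^ m * (E * \<i>)))"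
    by simp
  also have "\<dots> = 2 ^ m / 4 * (1 - (-1) ^ m * (E * \<i>)) / (\<i> ^ m * (C / (1 + \<i>)))"
    unfolding P using nz by (simp add: divide_simps)
  finally show ?thesis
    unfolding i1 c1 pm im W_def [symmetric] C_def [symmetric] P_def [symmetric] by (simp add: mult_ac)
qed

text \<open>On both rays the integrand is a nonzero or arbitrary constant (\<open>c1\<close>,
  \<open>c2\<close>) times the real function \<open>h (2 * t)\<close>. Integrability of
  \<open>h\<close> is read off from the lower ray by dividing by \<open>c1\<close>; the substitution
  \<open>x = 2 t\<close> accounts for the division by 2.\<close>

lemma berndt_integral_rays:
  fixes a :: real
  assumes m: "m \<ge> 1" and a: "a \<ge> 2 * real m"
  defines "h \<equiv> (\<lambda>x::real. x powr a / (cos x - cosh x) ^ m)"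
  shows "set_integrable lborel {0<..} h"
    and "(LBINT t:{0<..}. berndt_fun m a (of_real t * (1 - \<i>)) * (1 - \<i>)) -
           (LBINT t:{0<..}. berndt_fun m a (of_real t * (1 + \<i>)) * (1 + \<i>)) =
         (-2 * \<i>) ^ m / 2 powr complex_of_real a *
           ((1 - \<i>) powr a * (1 - \<i>) - (-1) ^ m * (1 + \<i>) powr a * (1 + \<i>)) *
           of_real ((LBINT x:{0<..}. h x) / 2)"
proof -
  define H where "H = (\<lambda>x::real. indicator {0<..} x *\<^sub>R h x)"
  have H2: "H (0 + 2 * t) = indicator {0<..} t *\<^sub>R h (2 * t)" for t
    by (auto simp: H_def indicator_def)
  define c1 where "c1 = (1 - \<i>) powr a * (-2 * \<i>) ^ m / 2 powr a * (1 - \<i>)"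
  define c2 where "c2 = (-1) ^ m * (1 + \<i>) powr a * (-2 * \<i>) ^ m / 2 powr a * (1 + \<i>)"
  have "1 - \<i> \<noteq> 0"
    by (simp add: complex_eq_iff)
  hence nz: "c1 \<noteq> 0"
    by (simp add: c1_def)
  have 1: "berndt_fun m a (of_real t * (1 - \<i>)) * (1 - \<i>) = c1 * of_real (h (2 * t))"
    and 2: "berndt_fun m a (of_real t * (1 + \<i>)) * (1 + \<i>) = c2 * of_real (h (2 * t))"
    if "t \<in> {0<..}" for t
    using that unfolding h_def c1_def c2_def by (simp_all only: berndt_fun_rays greaterThan_iff mult_ac)
  have "filterlim real at_top sequentially"
    by (rule filterlim_real_sequentially)
  moreover have "(\<lambda>N. 1 / (real N + 2)) \<longlonglongrightarrow> 0"
    by real_asymp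
  ultimately have "set_integrable lborel {0<..} (\<lambda>t. berndt_fun m a (of_real t * Complex 1 (-1)) * Complex 1 (-1))"
    using berndt_fun_ray_integral(1)[OF m a, of "-1" "\<lambda>N. 1 / (real N + 2)" real] by simp
  moreover have "Complex 1 (-1) = 1 - \<i>"
    by (simp add: complex_eq_iff)
  ultimately have "set_integrable lborel {0<..} (\<lambda>t. berndt_fun m a (of_real t * (1 - \<i>)) * (1 - \<i>))"
    by simp
  also have "?this \<longleftrightarrow> set_integrable lborel {0<..} (\<lambda>t. c1 * of_real (h (2 * t)))"
    by (intro set_integrable_cong refl 1)
  finally have "set_integrable lborel {0<..} (\<lambda>t. inverse c1 * (c1 * complex_of_real (h (2 * t))))"
    by (rule set_integrable_mult_right[rotated])
  hence "set_integrable lborel {0<..} (\<lambda>t. complex_of_real (h (2 * t)))"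
    using nz by (simp flip: mult.assoc)
  hence "integrable lborel (\<lambda>t. Re (indicator {0<..} t *\<^sub>R complex_of_real (h (2 * t))))"
    unfolding set_integrable_def by (rule integrable_Re)
  hence "integrable lborel (\<lambda>t. H (0 + 2 * t))"
    unfolding H2 by simp
  hence "integrable lborel H"
    by (subst (asm) lborel_integrable_real_affine_iff) auto
  thus "set_integrable lborel {0<..} h"
    by (simp add: set_integrable_def H_def)
  have "(LBINT x:{0<..}. h x) = integral\<^sup>L lborel H"
    by (simp add: set_lebesgue_integral_def H_def)
  also have "\<dots> = \<bar>2\<bar> *\<^sub>R integral\<^sup>L lborel (\<lambda>t. H (0 + 2 * t))"
    by (rule lborel_integral_real_affine) auto
  also have "integral\<^sup>L lborel (\<lambda>t. H (0 + 2 * t)) = (LBINT t:{0<..}. h (2 * t))"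
    unfolding H2 by (simp add: set_lebesgue_integral_def)
  finally have I: "(LBINT t:{0<..}. h (2 * t)) = (LBINT x:{0<..}. h x) / 2"
    by simp
  have "(LBINT t:{0<..}. berndt_fun m a (of_real t * (1 - \<i>)) * (1 - \<i>)) =
        (LBINT t:{0<..}. c1 * complex_of_real (h (2 * t)))"
    by (intro set_lebesgue_integral_cong) (use 1 in auto)
  also have "\<dots> = c1 * of_real ((LBINT x:{0<..}. h x) / 2)"
    unfolding I [symmetric] by (simp add: set_integral_complex_of_real)
  finally have J1: "(LBINT t:{0<..}. berndt_fun m a (of_real t * (1 - \<i>)) * (1 - \<i>)) =
    c1 * of_real ((LBINT x:{0<..}. h x) / 2)" .
  have "(LBINT t:{0<..}. berndt_fun m a (of_real t * (1 + \<i>)) * (1 + \<i>)) =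
        (LBINT t:{0<..}. c2 * complex_of_real (h (2 * t)))"
    by (intro set_lebesgue_integral_cong) (use 2 in auto)
  also have "\<dots> = c2 * of_real ((LBINT x:{0<..}. h x) / 2)"
    unfolding I [symmetric] by (simp add: set_integral_complex_of_real)
  finally have J2: "(LBINT t:{0<..}. berndt_fun m a (of_real t * (1 + \<i>)) * (1 + \<i>)) =
    c2 * of_real ((LBINT x:{0<..}. h x) / 2)" .
  have "complex_of_real (2 powr a) = 2 powr complex_of_real a"
    using powr_of_real[of 2 a] by simp
  hence "c1 - c2 = (-2 * \<i>) ^ m / 2 powr complex_of_real a *
           ((1 - \<i>) powr a * (1 - \<i>) - (-1) ^ m * (1 + \<i>) powr a * (1 + \<i>))"
    by (simp only: c1_def c2_def right_diff_distrib divide_inverse mult_ac)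
  thus "(LBINT t:{0<..}. berndt_fun m a (of_real t * (1 - \<i>)) * (1 - \<i>)) -
           (LBINT t:{0<..}. berndt_fun m a (of_real t * (1 + \<i>)) * (1 + \<i>)) =
         (-2 * \<i>) ^ m / 2 powr complex_of_real a *
           ((1 - \<i>) powr a * (1 - \<i>) - (-1) ^ m * (1 + \<i>) powr a * (1 + \<i>)) *
           of_real ((LBINT x:{0<..}. h x) / 2)"
    unfolding J1 J2 by (simp only: left_diff_distrib [symmetric])
qed

text \<open>The first four conjuncts ensure that the integral, the series, the iterated derivatives
  and the limits in the final identity are genuine and not default values of total
  functions.\<close>

theorem theorem3p5:
  fixes m :: nat and a :: real
  assumes "m \<ge> 1" and "a \<ge> 2 * real m"
  shows "set_integrable lborel {0<..} (\<lambda>x::real. x powr a / (cos x - cosh x) ^ m)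
    \<and> (\<forall>l \<le> (m - 1) div 2. \<forall>y > 0. summable (sinh_term m (a + 1 + 2 * real l - real m) y))
    \<and> (\<forall>l \<le> (m - 1) div 2. \<forall>k < m - 1 - 2 * l. \<forall>y > 0.
         (deriv ^^ k) (sinh_series m (a + 1 + 2 * real l - real m)) differentiable (at y))
    \<and> (\<forall>l \<le> (m - 1) div 2. \<forall>k \<le> m - 1 - 2 * l.
         \<exists>L. ((deriv ^^ k) (sinh_series m (a + 1 + 2 * real l - real m)) \<longlongrightarrow> L) (at pi))
    \<and> 2 powi (int m - 2) * (1 - (-1) ^ m * \<i> powr complex_of_real (a + 1))
        / (\<i> ^ m * (1 + \<i>) powr complex_of_real (a - 1))
        * complex_of_real (LBINT x:{0<..}. x powr a / (cos x - cosh x) ^ m)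
      = complex_of_real
          (\<Sum>l=0..(m - 1) div 2. \<Sum>j=0..m - 1 - 2 * l.
             (-1) ^ (l + 1) * 2 ^ l * gamma_coeff l m / fact (m - 1 - 2 * l - j)
             * (a gchoose j) * pi powr (a + 1 - real j)
             * Lim (at pi) ((deriv ^^ (m - 1 - 2 * l - j))
                 (sinh_series m (a + 1 + 2 * real l - real m))))"
proof (intro conjI allI impI)
  show "set_integrable lborel {0<..} (\<lambda>x::real. x powr a / (cos x - cosh x) ^ m)"
    by (rule berndt_integral_rays(1)[OF assms])
  show "summable (sinh_term m (a + 1 + 2 * real l - real m) y)" if "y > 0" for l y
    using assms(1) that by (rule summable_sinh_term)
  show "(deriv ^^ k) (sinh_series m (a + 1 + 2 * real l - real m)) differentiable (at y)" if "y > 0" for l k y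
    using assms(1) that by (rule higher_deriv_sinh_series(2))
  show "\<exists>L. ((deriv ^^ k) (sinh_series m (a + 1 + 2 * real l - real m)) \<longlongrightarrow> L) (at pi)" for l k
    using tendsto_higher_deriv_sinh_series[OF assms(1)] by blast
  define I where "I = (LBINT x:{0<..}. x powr a / (cos x - cosh x) ^ m)"
  define S where "S = (\<Sum>l=0..(m - 1) div 2. \<Sum>j=0..m - 1 - 2 * l.
       (-2) ^ l * gamma_coeff l m / fact (m - 1 - 2 * l - j) * (a gchoose j) * pi powr (a - real j) *
       (deriv ^^ (m - 1 - 2 * l - j)) (sinh_series m (a + 1 + 2 * real l - real m)) pi)"
  define J where "J = (LBINT t:{0<..}. berndt_fun m a (of_real t * (1 - \<i>)) * (1 - \<i>)) -
           (LBINT t:{0<..}. berndt_fun m a (of_real t * (1 + \<i>)) * (1 + \<i>))"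
  have "(\<lambda>N. 2 * pi * \<i> * (\<Sum>n<N. residue (berndt_fun m a) (of_real (real (Suc n) * pi)))) \<longlonglongrightarrow>
          2 * pi * \<i> * of_real S"
    using residue_berndt_fun_sums[OF assms(1), of a] unfolding sums_def S_def
    by (intro tendsto_intros)
  moreover have "(\<Sum>n<N. residue (berndt_fun m a) (of_real (real (Suc n) * pi))) =
                 (\<Sum>n=1..N. residue (berndt_fun m a) (of_real (real n * pi)))" for N
    by (rule sum.reindex_bij_witness[of _ "\<lambda>n. n - 1" Suc]) auto
  ultimately have J: "J = 2 * pi * \<i> * of_real S"
    using residue_sum_berndt_fun[OF assms] unfolding J_def by (simp add: LIMSEQ_unique)
  \<comment> \<open>The factor \<open>\<i> / 4\<close> of \<open>berndt_constant\<close> times the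
    integral is \<open>\<i> / 2\<close> times half the integral, which is what the rays provide.
    Then \<open>\<i> / 2 * (2 * \<pi> * \<i>) = -\<pi>\<close> is the source of the sign and of the
    additional power of \<pi> in the result.\<close>
  have "2 powi (int m - 2) * (1 - (-1) ^ m * \<i> powr complex_of_real (a + 1))
        / (\<i> ^ m * (1 + \<i>) powr complex_of_real (a - 1)) * of_real I = \<i> / 2 * J"
    unfolding berndt_constant J_def berndt_integral_rays(2)[OF assms] I_def by simp
  also have "\<dots> = of_real (-pi * S)"
    unfolding J by (simp add: complex_eq_iff)
  also have "-pi * S = (\<Sum>l=0..(m - 1) div 2. \<Sum>j=0..m - 1 - 2 * l.
             (-1) ^ (l + 1) * 2 ^ l * gamma_coeff l m / fact (m - 1 - 2 * l - j)
             * (a gchoose j) * pi powr (a + 1 - real j)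
             * Lim (at pi) ((deriv ^^ (m - 1 - 2 * l - j))
                 (sinh_series m (a + 1 + 2 * real l - real m))))"
    unfolding S_def sum_distrib_left
  proof (intro sum.cong refl)
    fix l j
    have "pi powr (a + 1 - real j) = pi * pi powr (a - real j)"
      using powr_add[of pi "a - real j" 1] by (simp add: algebra_simps)
    moreover have "(-2 :: real) ^ l = (-1) ^ l * 2 ^ l"
      by (simp flip: power_mult_distrib)
    ultimately show "-pi * ((-2) ^ l * gamma_coeff l m / fact (m - 1 - 2 * l - j) * (a gchoose j) * pi powr (a - real j) *
       (deriv ^^ (m - 1 - 2 * l - j)) (sinh_series m (a + 1 + 2 * real l - real m)) pi) =
       (-1) ^ (l + 1) * 2 ^ l * gamma_coeff l m / fact (m - 1 - 2 * l - j)
             * (a gchoose j) * pi powr (a + 1 - real j)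
             * Lim (at pi) ((deriv ^^ (m - 1 - 2 * l - j))
                 (sinh_series m (a + 1 + 2 * real l - real m)))"
      by (simp add: Lim_higher_deriv_sinh_series[OF assms(1)])
  qed
  finally show "2 powi (int m - 2) * (1 - (-1) ^ m * \<i> powr complex_of_real (a + 1))
        / (\<i> ^ m * (1 + \<i>) powr complex_of_real (a - 1))
        * complex_of_real (LBINT x:{0<..}. x powr a / (cos x - cosh x) ^ m)
      = complex_of_real
          (\<Sum>l=0..(m - 1) div 2. \<Sum>j=0..m - 1 - 2 * l.
             (-1) ^ (l + 1) * 2 ^ l * gamma_coeff l m / fact (m - 1 - 2 * l - j)
             * (a gchoose j) * pi powr (a + 1 - real j)
             * Lim (at pi) ((deriv ^^ (m - 1 - 2 * l - j))
                 (sinh_series m (a + 1 + 2 * real l - real m))))"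
    by (simp only: I_def)
qed

end
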